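(* Let $G$ be a finite undirected graph, let $\mathbb F$ be a field with characteristic not equal to $2$, let $\mathcal C(G,\mathbb F)$ be the $\mathbb F$-cycle space of $G$, and let $TS$ be the subspace of $\mathcal C(G,\mathbb F)$ generated by all simple triangles and squares (circuits of length 3 and 4) of $G$. Then $$H_1(G,\mathbb F)\cong\mathcal C(G,\mathbb F)/TS,$$ where $H_1(G,\mathbb F)$ is the first path homology group of $G$.
   Context: Graphs are simple, $G=(V,E)$; $\vec E$ contains both arcs $xy$ and $yx$ for every edge $\{x,y\}$, and $G$ is regarded as a directed graph with arc set $\vec E$. Cycle space: $\mathcal C(G,\mathbb F)$ is the $\mathbb F$-vector space of functions $\phi:\vec E\to\mathbb F$ with $\phi(xy)=-\phi(yx)$ and $\sum_{y:\,xy\in\vec E}\phi(xy)=0$ for all $x\in V$. A circuit (simple cycle) $(x_1,\dots,x_n)$, $n\ge3$, is identified with the element that is $1$ on the arcs $x_1x_2,\dots,x_nx_1$, $-1$ on the reversed arcs and $0$ elsewhere. Squares need not be induced. Path homology: for $m\ge0$ let $\Lambda_m$ be the $\mathbb F$-vector space with basis $\{e_{i_0\dots i_m}:i_0,\dots,i_m\in V\}$, $\Lambda_{-1}=0$, and let $\partial:\Lambda_m\to\Lambda_{m-1}$ be linear with $\partial e_{i_0\dots i_m}=\sum_{k=0}^m(-1)^ke_{i_0\dots\hat{i_k}\dots i_m}$ (hat denotes omission), $\partial=0$ on $\Lambda_0$. Let $I_m\subset\Lambda_m$ be the span of those $e_{i_0\dots i_m}$ with $i_k=i_{k+1}$ for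 some $k$, and $\mathcal R_m=\Lambda_m/I_m$ with the induced $\partial$. Let $\mathcal A_m\subset\mathcal R_m$ be the span of those $e_{i_0\dots i_m}$ with $i_ki_{k+1}\in\vec E$ for all $k$, and $\Omega_m=\{p\in\mathcal A_m:\partial p\in\mathcal A_{m-1}\}$. Then $\partial\Omega_m\subseteq\Omega_{m-1}$, $\partial^2=0$, and $H_n(G,\mathbb F)=\ker(\partial|_{\Omega_n})/\operatorname{im}(\partial|_{\Omega_{n+1}})$. *)

theory Defs
  imports
    "HOL-Algebra.Algebraic_Closure_Type"
    "Graph_Theory.Pair_Digraph"
begin

section \<open>Vector spaces over a type-class field\<close>

text \<open>
  A vector space over the field \<open>'f\<close> is a HOL-Algebra \<open>module\<close> record over
  \<open>ring_of_type_algebra :: 'f ring\<close>; explicit carriers are needed to form iterated quotients.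
  The fields \<open>mult\<close> and \<open>one\<close>, which the record inherits from rings, carry no meaning.
\<close>

text \<open>Functions \<open>S \<Rightarrow> 'f\<close> are represented by total functions that vanish outside \<open>S\<close>. For finite
  \<open>S\<close> this is also the vector space with basis \<open>S\<close>, \<open>basis_vec s\<close> being the basis element of \<open>s\<close>.\<close>

definition fun_space :: "'s set \<Rightarrow> ('f::field, 's \<Rightarrow> 'f) module" where
  "fun_space S =
     \<lparr>carrier = {f. \<forall>s. s \<notin> S \<longrightarrow> f s = 0}, monoid.mult = undefined, one = undefined,
      zero = (\<lambda>_. 0), add = (\<lambda>f g s. f s + g s), module.smult = (\<lambda>c f s. c * f s)\<rparr>"

definition basis_vec :: "'s \<Rightarrow> 's \<Rightarrow> 'f::field" where
  "basis_vec s = (\<lambda>t. if t = s then 1 else 0)"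

definition lin_span :: "('f::field, 'v) module \<Rightarrow> 'v set \<Rightarrow> 'v set" where
  "lin_span M B = (\<lambda>W. submodule W (ring_of_type_algebra :: 'f ring) M) hull B"

definition quotient_space :: "('f::field, 'v) module \<Rightarrow> 'v set \<Rightarrow> ('f, 'v set) module" where
  "quotient_space M W =
     \<lparr>carrier = a_rcosets\<^bsub>M\<^esub> W, monoid.mult = undefined, one = undefined,
      zero = W, add = (\<lambda>A B. A <+>\<^bsub>M\<^esub> B),
      module.smult = (\<lambda>c A. \<Union>a\<in>A. W +>\<^bsub>M\<^esub> (c \<odot>\<^bsub>M\<^esub> a))\<rparr>"

definition vs_isomorphic :: "('f::field, 'v) module \<Rightarrow> ('f, 'w) module \<Rightarrow> bool"
    (infix \<open>\<cong>\<^sub>v\<close> 50) where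
  "M \<cong>\<^sub>v N \<longleftrightarrow>
     (\<exists>h \<in> iso (add_monoid M) (add_monoid N).
        \<forall>c. \<forall>x \<in> carrier M. h (c \<odot>\<^bsub>M\<^esub> x) = c \<odot>\<^bsub>N\<^esub> h x)"


section \<open>Cycle space\<close>

text \<open>
  A finite simple graph is a \<open>pair_graph\<close>: a finite, symmetric, loopfree digraph whose arc set
  \<open>parcs G\<close> contains both \<open>(x, y)\<close> and \<open>(y, x)\<close> for every edge.
\<close>

definition cycle_space :: "'a pair_pre_digraph \<Rightarrow> ('f::field, 'a \<times> 'a \<Rightarrow> 'f) module" where
  "cycle_space G = (fun_space (parcs G))
     \<lparr>carrier := {\<phi> \<in> carrier (fun_space (parcs G)).
        (\<forall>x y. (x, y) \<in> parcs G \<longrightarrow> \<phi> (x, y) = - \<phi> (y, x)) \<and>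
        (\<forall>x \<in> pverts G. (\<Sum>y | (x, y) \<in> parcs G. \<phi> (x, y)) = 0)}\<rparr>"

definition circuit_arcs :: "'a list \<Rightarrow> ('a \<times> 'a) set" where
  "circuit_arcs xs = {(xs ! i, xs ! (Suc i mod length xs)) | i. i < length xs}"

definition circuit :: "'a pair_pre_digraph \<Rightarrow> 'a list \<Rightarrow> bool" where
  "circuit G xs \<longleftrightarrow> 3 \<le> length xs \<and> distinct xs \<and> circuit_arcs xs \<subseteq> parcs G"

definition circuit_vec :: "'a list \<Rightarrow> 'a \<times> 'a \<Rightarrow> 'f::field" where
  "circuit_vec xs = (\<lambda>(x, y). if (x, y) \<in> circuit_arcs xs then 1
                              else if (y, x) \<in> circuit_arcs xs then - 1 else 0)"

definition TS :: "'a pair_pre_digraph \<Rightarrow> ('a \<times> 'a \<Rightarrow> 'f::field) set" where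
  "TS G = lin_span (cycle_space G) {circuit_vec xs | xs. circuit G xs \<and> length xs \<in> {3, 4}}"


section \<open>Path homology\<close>

text \<open>
  The basis element indexed by \<open>i\<^sub>0, \<dots>, i\<^sub>m\<close> is \<open>basis_vec [i\<^sub>0, \<dots>, i\<^sub>m]\<close>, so degree \<open>m\<close> means
  length \<open>m + 1\<close>. Degrees are integers so that \<open>m - 1\<close> is meaningful for \<open>m = 0\<close>; the empty list
  is excluded because the spaces of negative degree are zero.
\<close>

definition elem_paths :: "'a pair_pre_digraph \<Rightarrow> int \<Rightarrow> 'a list set" where
  "elem_paths G m = {xs. xs \<noteq> [] \<and> int (length xs) = m + 1 \<and> set xs \<subseteq> pverts G}"

definition path_space :: "'a pair_pre_digraph \<Rightarrow> int \<Rightarrow> ('f::field, 'a list \<Rightarrow> 'f) module"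
    (\<open>\<Lambda>\<close>) where
  "\<Lambda> G m = fun_space (elem_paths G m)"

text \<open>The linear extension of the alternating sum over the omissions of one entry; elements of
  \<open>\<Lambda> G m\<close> have finite support.\<close>

definition boundary :: "int \<Rightarrow> ('a list \<Rightarrow> 'f::field) \<Rightarrow> 'a list \<Rightarrow> 'f" where
  "boundary m f = (if m \<le> 0 then (\<lambda>_. 0) else
     (\<lambda>ys. \<Sum>xs | f xs \<noteq> 0. f xs *
        (\<Sum>k < length xs. (- 1) ^ k * basis_vec (take k xs @ drop (Suc k) xs) ys)))"

definition irregular_space :: "'a pair_pre_digraph \<Rightarrow> int \<Rightarrow> ('a list \<Rightarrow> 'f::field) set" where
  "irregular_space G m = lin_span (\<Lambda> G m)
     {basis_vec xs | xs. xs \<in> elem_paths G m \<and>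
        (\<exists>k. Suc k < length xs \<and> xs ! k = xs ! Suc k)}"

definition regular_space ::
    "'a pair_pre_digraph \<Rightarrow> int \<Rightarrow> ('f::field, ('a list \<Rightarrow> 'f) set) module" where
  "regular_space G m = quotient_space (\<Lambda> G m) (irregular_space G m)"

text \<open>The map induced by \<open>boundary\<close> on cosets.\<close>

definition reg_boundary ::
    "'a pair_pre_digraph \<Rightarrow> int \<Rightarrow> ('a list \<Rightarrow> 'f::field) set \<Rightarrow> ('a list \<Rightarrow> 'f) set" where
  "reg_boundary G m A =
     (\<Union>f\<in>A. irregular_space G (m - 1) +>\<^bsub>\<Lambda> G (m - 1)\<^esub> boundary m f)"

definition allowed_space ::
    "'a pair_pre_digraph \<Rightarrow> int \<Rightarrow> ('a list \<Rightarrow> 'f::field) set set" where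
  "allowed_space G m = lin_span (regular_space G m)
     {irregular_space G m +>\<^bsub>\<Lambda> G m\<^esub> basis_vec xs | xs. xs \<in> elem_paths G m \<and>
        (\<forall>k. Suc k < length xs \<longrightarrow> (xs ! k, xs ! Suc k) \<in> parcs G)}"

definition Omega :: "'a pair_pre_digraph \<Rightarrow> int \<Rightarrow> ('a list \<Rightarrow> 'f::field) set set" where
  "Omega G m = {p \<in> allowed_space G m. reg_boundary G m p \<in> allowed_space G (m - 1)}"

definition path_cycles :: "'a pair_pre_digraph \<Rightarrow> int \<Rightarrow> ('a list \<Rightarrow> 'f::field) set set" where
  "path_cycles G n = {p \<in> Omega G n. reg_boundary G n p = \<zero>\<^bsub>regular_space G (n - 1)\<^esub>}"

definition path_boundaries :: "'a pair_pre_digraph \<Rightarrow> int \<Rightarrow> ('a list \<Rightarrow> 'f::field) set set" where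
  "path_boundaries G n = reg_boundary G (n + 1) ` Omega G (n + 1)"

definition path_homology ::
    "'a pair_pre_digraph \<Rightarrow> int \<Rightarrow> ('f::field, ('a list \<Rightarrow> 'f) set set) module" where
  "path_homology G n =
     quotient_space ((regular_space G n)\<lparr>carrier := path_cycles G n\<rparr>) (path_boundaries G n)"

end

theory Submission
  imports Defs
begin

text \<open>
  Let \<open>Z\<close> and \<open>B\<close> be the path cycles and path boundaries of degree one. Since all vertices are allowed
  paths, an element of \<open>Z\<close> is a function \<open>p\<close> on the arcs whose inflow equals its outflow at every
  vertex. The isomorphism is induced by antisymmetrization, the linear map \<open>\<alpha>\<close> with
  \<open>(\<alpha> p) (x, y) = p (x, y) - p (y, x)\<close>, which takes \<open>Z\<close> into the cycle space. It is onto because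
  the characteristic is not two: an element \<open>\<phi>\<close> of the cycle space is the image of \<open>\<phi> / 2\<close>
  (\<open>antisym_map_surj\<close>). By the first isomorphism theorem (\<open>quotient_space_isomorphicI\<close>) it remains
  to see that \<open>B\<close> is the preimage of the span \<open>TS\<close> of triangles and squares
  (\<open>path_coset_boundaries_iff\<close>). This splits into two facts.

  First, the kernel of \<open>\<alpha>\<close> lies in \<open>B\<close>. It consists of the symmetric functions, and these
  are combinations of \<open>e\<^sub>x\<^sub>y + e\<^sub>y\<^sub>x\<close>, the boundary of the allowed path \<open>e\<^sub>x\<^sub>y\<^sub>x\<close>; the middle face
  \<open>e\<^sub>x\<^sub>x\<close> vanishes among regular paths. The coefficients are again halves (\<open>symmetric_chain_filled\<close>).

  Second, \<open>\<alpha>\<close> maps \<open>B\<close> onto \<open>TS\<close>. A triangle is the image of the boundary of \<open>e\<^sub>x\<^sub>y\<^sub>z\<close>, and a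
  square of the boundary of \<open>e\<^sub>x\<^sub>y\<^sub>z - e\<^sub>x\<^sub>w\<^sub>z\<close> (\<open>TS_filled\<close>). Conversely an element of \<open>Omega\<close> in
  degree two is a combination of allowed \<open>e\<^sub>x\<^sub>y\<^sub>z\<close> in which, for each pair \<open>x \<noteq> z\<close> that is not
  an arc, the coefficients of all \<open>e\<^sub>x\<^sub>y\<^sub>z\<close> sum to zero, since \<open>e\<^sub>x\<^sub>z\<close> must not occur in the boundary.
  Comparing each of these with one fixed \<open>e\<^sub>x\<^sub>w\<^sub>z\<close> therefore exhibits the element as a
  combination of paths \<open>e\<^sub>x\<^sub>y\<^sub>x\<close>, of paths that close up to a triangle, and of differences that close up
  to a square (\<open>antisym_map_boundary_in_TS\<close>).

  Elements of the path homology spaces are cosets. The proof works with representatives, using that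
  modulo irregular chains an allowed element is represented by a function supported on allowed paths,
  and that a coset is determined by the values of a representative on regular paths
  (\<open>allowed_space_eq\<close>, \<open>path_coset_eq_iff\<close>).
\<close>

section \<open>Linear maps, spans and quotients\<close>

abbreviation scalars :: "'f::field ring" where
  "scalars \<equiv> ring_of_type_algebra"

lemma scalars_simps [simp]:
  "carrier scalars = UNIV" "a \<oplus>\<^bsub>scalars\<^esub> b = a + b" "a \<otimes>\<^bsub>scalars\<^esub> b = a * b"
  "\<one>\<^bsub>scalars\<^esub> = 1" "\<zero>\<^bsub>scalars\<^esub> = 0"
  by (simp_all add: ring_of_type_algebra_def)

lemma cring_scalars: "cring (scalars :: 'f::field ring)"
  by (rule cring_from_type_algebra)

text \<open>Closure under negation follows from closure under scalar multiplication, by \<open>-1\<close>.\<close>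

lemma subspaceI:
  fixes M :: "('f::field, 'v) module"
  assumes M: "module scalars M" and H: "H \<subseteq> carrier M" "\<zero>\<^bsub>M\<^esub> \<in> H"
    and add: "\<And>x y. x \<in> H \<Longrightarrow> y \<in> H \<Longrightarrow> x \<oplus>\<^bsub>M\<^esub> y \<in> H"
    and smult: "\<And>c x. x \<in> H \<Longrightarrow> c \<odot>\<^bsub>M\<^esub> x \<in> H"
  shows "submodule H scalars M"
proof -
  interpret M: module scalars M by (rule M)
  show ?thesis
  proof (rule M.submoduleI[OF H])
    fix x assume x: "x \<in> H"
    then have "\<ominus>\<^bsub>M\<^esub> x = (\<ominus>\<^bsub>scalars\<^esub> 1) \<odot>\<^bsub>M\<^esub> x"
      using M.smult_l_minus[of 1 x] M.smult_one[of x] H by auto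
    then show "\<ominus>\<^bsub>M\<^esub> x \<in> H" using smult[OF x] by simp
  qed (use assms in auto)
qed

lemma subspaceD:
  fixes M :: "('f::field, 'v) module"
  assumes "submodule H scalars M"
  shows "H \<subseteq> carrier M" "\<zero>\<^bsub>M\<^esub> \<in> H"
    "\<And>x y. x \<in> H \<Longrightarrow> y \<in> H \<Longrightarrow> x \<oplus>\<^bsub>M\<^esub> y \<in> H" "\<And>c x. x \<in> H \<Longrightarrow> c \<odot>\<^bsub>M\<^esub> x \<in> H"
proof -
  interpret submodule H scalars M by (rule assms)
  show "H \<subseteq> carrier M" "\<zero>\<^bsub>M\<^esub> \<in> H"
    "\<And>x y. x \<in> H \<Longrightarrow> y \<in> H \<Longrightarrow> x \<oplus>\<^bsub>M\<^esub> y \<in> H" "\<And>c x. x \<in> H \<Longrightarrow> c \<odot>\<^bsub>M\<^esub> x \<in> H"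
    using subset one_closed m_closed smult_closed by auto
qed

definition linear_map :: "('f::field, 'v) module \<Rightarrow> ('f, 'w) module \<Rightarrow> ('v \<Rightarrow> 'w) \<Rightarrow> bool" where
  "linear_map M N h \<longleftrightarrow> h \<in> carrier M \<rightarrow> carrier N \<and>
     (\<forall>x \<in> carrier M. \<forall>y \<in> carrier M. h (x \<oplus>\<^bsub>M\<^esub> y) = h x \<oplus>\<^bsub>N\<^esub> h y) \<and>
     (\<forall>c. \<forall>x \<in> carrier M. h (c \<odot>\<^bsub>M\<^esub> x) = c \<odot>\<^bsub>N\<^esub> h x)"

lemma linear_mapD:
  assumes "linear_map M N h"
  shows "x \<in> carrier M \<Longrightarrow> h x \<in> carrier N"
    "x \<in> carrier M \<Longrightarrow> y \<in> carrier M \<Longrightarrow> h (x \<oplus>\<^bsub>M\<^esub> y) = h x \<oplus>\<^bsub>N\<^esub> h y"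
    "x \<in> carrier M \<Longrightarrow> h (c \<odot>\<^bsub>M\<^esub> x) = c \<odot>\<^bsub>N\<^esub> h x"
  using assms by (auto simp: linear_map_def)

lemma linear_map_comp:
  assumes "linear_map M N h" "linear_map N P k"
  shows "linear_map M P (\<lambda>x. k (h x))"
  unfolding linear_map_def[of M P] using linear_mapD[OF assms(1)] linear_mapD[OF assms(2)] by simp

lemma linear_map_zero:
  fixes M :: "('f::field, 'v) module" and N :: "('f, 'w) module"
  assumes M: "module scalars M" and N: "module scalars N" and h: "linear_map M N h"
  shows "h \<zero>\<^bsub>M\<^esub> = \<zero>\<^bsub>N\<^esub>"
proof -
  interpret M: module scalars M by (rule M)
  interpret N: module scalars N by (rule N)
  have "h \<zero>\<^bsub>M\<^esub> = h (0 \<odot>\<^bsub>M\<^esub> \<zero>\<^bsub>M\<^esub>)"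
    using M.smult_l_null[of "\<zero>\<^bsub>M\<^esub>"] by simp
  also have "\<dots> = 0 \<odot>\<^bsub>N\<^esub> h \<zero>\<^bsub>M\<^esub>" by (rule linear_mapD[OF h]) simp
  also have "\<dots> = \<zero>\<^bsub>N\<^esub>"
    using N.smult_l_null[of "h \<zero>\<^bsub>M\<^esub>"] linear_mapD(1)[OF h] by simp
  finally show ?thesis .
qed

lemma subspace_image:
  fixes M :: "('f::field, 'v) module" and N :: "('f, 'w) module"
  assumes M: "module scalars M" and N: "module scalars N" and h: "linear_map M N h"
    and V: "submodule V scalars M"
  shows "submodule (h ` V) scalars N"
proof (rule subspaceI[OF N])
  note V' = subspaceD[OF V] and h' = linear_mapD[OF h]
  show "h ` V \<subseteq> carrier N" using V'(1) h'(1) by blast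
  show "\<zero>\<^bsub>N\<^esub> \<in> h ` V" using V'(2) linear_map_zero[OF M N h] by force
  fix x y assume "x \<in> h ` V" "y \<in> h ` V"
  then obtain a b where "a \<in> V" "b \<in> V" "x = h a" "y = h b" by blast
  then show "x \<oplus>\<^bsub>N\<^esub> y \<in> h ` V"
    using h'(2)[of a b] V'(1) V'(3)[of a b] by (metis imageI subsetD)
next
  note V' = subspaceD[OF V] and h' = linear_mapD[OF h]
  fix c x assume "x \<in> h ` V"
  then obtain a where "a \<in> V" "x = h a" by blast
  then show "c \<odot>\<^bsub>N\<^esub> x \<in> h ` V"
    using h'(3)[of a c] V'(1) V'(4)[of a c] by (metis imageI subsetD)
qed

lemma subspace_vimage:
  fixes M :: "('f::field, 'v) module" and N :: "('f, 'w) module"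
  assumes M: "module scalars M" and N: "module scalars N" and h: "linear_map M N h"
    and U: "submodule U scalars N"
  shows "submodule {x \<in> carrier M. h x \<in> U} scalars M"
proof -
  interpret M: module scalars M by (rule M)
  show ?thesis
    by (rule subspaceI[OF M])
      (use linear_map_zero[OF M N h] linear_mapD[OF h] subspaceD[OF U] in auto)
qed

lemma subspace_lin_span:
  fixes M :: "('f::field, 'v) module"
  assumes M: "module scalars M" and B: "B \<subseteq> carrier M"
  shows "submodule (lin_span M B) scalars M"
proof -
  interpret M: module scalars M by (rule M)
  have carr: "carrier M \<in> {W. submodule W scalars M \<and> B \<subseteq> W}"
    using M.carrier_is_submodule B by simp
  show ?thesis
    unfolding lin_span_def hull_def
  proof (rule subspaceI[OF M])
    show "\<Inter> {W. submodule W scalars M \<and> B \<subseteq> W} \<subseteq> carrier M" using carr by blast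
  qed (simp_all add: subspaceD)
qed

lemma lin_span_superset: "B \<subseteq> lin_span M B"
  unfolding lin_span_def by (rule hull_subset)

lemma lin_span_minimal:
  fixes M :: "('f::field, 'v) module"
  assumes "B \<subseteq> H" "submodule H scalars M"
  shows "lin_span M B \<subseteq> H"
  unfolding lin_span_def using assms by (rule hull_minimal)

text \<open>Images and preimages of subspaces are subspaces, so the image of a span contains, and is
  contained in, the span of the image. Applied to a quotient map this describes spans in a quotient
  by representatives.\<close>

lemma lin_span_image:
  fixes M :: "('f::field, 'v) module" and N :: "('f, 'w) module"
  assumes M: "module scalars M" and N: "module scalars N" and h: "linear_map M N h"
    and B: "B \<subseteq> carrier M"
  shows "lin_span N (h ` B) = h ` lin_span M B"
proof
  have hB: "h ` B \<subseteq> carrier N" using B linear_mapD(1)[OF h] by blast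
  have "lin_span M B \<subseteq> {x \<in> carrier M. h x \<in> lin_span N (h ` B)}"
    by (intro lin_span_minimal subspace_vimage[OF M N h] subspace_lin_span N hB)
      (use B lin_span_superset[of "h ` B" N] in auto)
  then show "h ` lin_span M B \<subseteq> lin_span N (h ` B)" by blast
  show "lin_span N (h ` B) \<subseteq> h ` lin_span M B"
    by (intro lin_span_minimal subspace_image[OF M N h] subspace_lin_span M B image_mono
        lin_span_superset)
qed

lemma carrier_quotient_space:
  "carrier (quotient_space M W) = (\<lambda>x. W +>\<^bsub>M\<^esub> x) ` carrier M"
  by (auto simp: quotient_space_def A_RCOSETS_def RCOSETS_def a_r_coset_def)

lemma abelian_subgroup_subspace:
  fixes M :: "('f::field, 'v) module"
  assumes M: "module scalars M" and W: "submodule W scalars M"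
  shows "abelian_subgroup W M"
proof -
  interpret M: module scalars M by (rule M)
  interpret W: submodule W scalars M by (rule W)
  show ?thesis
    by (intro abelian_subgroupI3 additive_subgroup.intro W.subgroup_axioms M.abelian_group_axioms)
qed

lemma coset_eq_iff:
  fixes M :: "('f::field, 'v) module"
  assumes M: "module scalars M" and W: "submodule W scalars M"
    and x: "x \<in> carrier M" and y: "y \<in> carrier M"
  shows "W +>\<^bsub>M\<^esub> x = W +>\<^bsub>M\<^esub> y \<longleftrightarrow> (\<exists>w \<in> W. x = w \<oplus>\<^bsub>M\<^esub> y)"
proof -
  interpret W: abelian_subgroup W M by (rule abelian_subgroup_subspace[OF M W])
  have "W +>\<^bsub>M\<^esub> x = W +>\<^bsub>M\<^esub> y \<longleftrightarrow> x \<in> W +>\<^bsub>M\<^esub> y"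
    using W.a_repr_independence'[of x y] W.a_repr_independenceD[of x y] W.a_rcos_self[OF x] x y
    by metis
  then show ?thesis by (auto simp: a_r_coset_def')
qed

lemma coset_self:
  fixes M :: "('f::field, 'v) module"
  assumes M: "module scalars M" and W: "submodule W scalars M" and x: "x \<in> carrier M"
  shows "x \<in> W +>\<^bsub>M\<^esub> x"
proof -
  interpret W: abelian_subgroup W M by (rule abelian_subgroup_subspace[OF M W])
  show ?thesis by (rule W.a_rcos_self[OF x])
qed

text \<open>The scalar multiple of a coset is a union of cosets, one for each representative; this is a
  single coset because all of them coincide.\<close>

lemma linear_map_coset:
  fixes M :: "('f::field, 'v) module"
  assumes M: "module scalars M" and W: "submodule W scalars M"
  shows "linear_map M (quotient_space M W) (\<lambda>x. W +>\<^bsub>M\<^esub> x)"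
proof -
  interpret M: module scalars M by (rule M)
  interpret W: abelian_subgroup W M by (rule abelian_subgroup_subspace[OF M W])
  note W' = subspaceD[OF W]
  have "c \<odot>\<^bsub>quotient_space M W\<^esub> (W +>\<^bsub>M\<^esub> x) = W +>\<^bsub>M\<^esub> (c \<odot>\<^bsub>M\<^esub> x)" if x: "x \<in> carrier M" for c x
  proof -
    have "W +>\<^bsub>M\<^esub> (c \<odot>\<^bsub>M\<^esub> a) = W +>\<^bsub>M\<^esub> (c \<odot>\<^bsub>M\<^esub> x)" if "a \<in> W +>\<^bsub>M\<^esub> x" for a
    proof -
      obtain w where w: "w \<in> W" "a = w \<oplus>\<^bsub>M\<^esub> x" using \<open>a \<in> W +>\<^bsub>M\<^esub> x\<close> by (auto simp: a_r_coset_def')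
      then have w': "w \<in> carrier M" using W' by blast
      have "c \<odot>\<^bsub>M\<^esub> a = c \<odot>\<^bsub>M\<^esub> w \<oplus>\<^bsub>M\<^esub> c \<odot>\<^bsub>M\<^esub> x"
        using w w' x M.smult_r_distr[of c w x] by simp
      then show ?thesis using w w' x W'(4)[of w c]
        by (subst coset_eq_iff[OF M W]) (auto intro: M.smult_closed)
    qed
    then have "(\<Union>a \<in> W +>\<^bsub>M\<^esub> x. W +>\<^bsub>M\<^esub> (c \<odot>\<^bsub>M\<^esub> a)) = W +>\<^bsub>M\<^esub> (c \<odot>\<^bsub>M\<^esub> x)"
      by (intro UN_constant_eq[OF W.a_rcos_self[OF x]]) blast
    then show ?thesis by (simp add: quotient_space_def)
  qed
  then show ?thesis
    by (auto simp: linear_map_def carrier_quotient_space)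
      (auto simp: quotient_space_def W.a_rcos_sum)
qed

text \<open>Every axiom is transported from \<open>M\<close> along the quotient map, which is onto and
  respects the operations.\<close>

lemma module_quotient_space:
  fixes M :: "('f::field, 'v) module"
  assumes M: "module scalars M" and W: "submodule W scalars M"
  shows "module scalars (quotient_space M W)"
proof -
  interpret M: module scalars M by (rule M)
  interpret W: abelian_subgroup W M by (rule abelian_subgroup_subspace[OF M W])
  let ?Q = "quotient_space M W"
  note q = linear_mapD[OF linear_map_coset[OF M W]]
  have zero: "\<zero>\<^bsub>?Q\<^esub> = W +>\<^bsub>M\<^esub> \<zero>\<^bsub>M\<^esub>"
    using subspaceD(2)[OF W] W.a_rcos_const by (simp add: quotient_space_def)
  have ab: "abelian_group ?Q"
  proof (rule abelian_groupI)
    fix x assume "x \<in> carrier ?Q"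
    then obtain u where u: "u \<in> carrier M" "x = W +>\<^bsub>M\<^esub> u" by (auto simp: carrier_quotient_space)
    have "W +>\<^bsub>M\<^esub> (\<ominus>\<^bsub>M\<^esub> u) \<in> carrier ?Q" using q(1) u by simp
    moreover have "(W +>\<^bsub>M\<^esub> (\<ominus>\<^bsub>M\<^esub> u)) \<oplus>\<^bsub>?Q\<^esub> x = \<zero>\<^bsub>?Q\<^esub>"
      unfolding u(2) zero q(2)[OF M.M.a_inv_closed[OF u(1)] u(1), symmetric] M.M.l_neg[OF u(1)]
      by (rule refl)
    ultimately show "\<exists>y\<in>carrier ?Q. y \<oplus>\<^bsub>?Q\<^esub> x = \<zero>\<^bsub>?Q\<^esub>" by blast
  next
    fix x y assume "x \<in> carrier ?Q" "y \<in> carrier ?Q"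
    then obtain u v where u: "u \<in> carrier M" "x = W +>\<^bsub>M\<^esub> u" "v \<in> carrier M" "y = W +>\<^bsub>M\<^esub> v"
      by (auto simp: carrier_quotient_space)
    then have xy: "x \<oplus>\<^bsub>?Q\<^esub> y = W +>\<^bsub>M\<^esub> (u \<oplus>\<^bsub>M\<^esub> v)" and yx: "y \<oplus>\<^bsub>?Q\<^esub> x = W +>\<^bsub>M\<^esub> (v \<oplus>\<^bsub>M\<^esub> u)"
      using q(2) by simp_all
    show "x \<oplus>\<^bsub>?Q\<^esub> y \<in> carrier ?Q" unfolding xy using q(1) u by simp
    show "x \<oplus>\<^bsub>?Q\<^esub> y = y \<oplus>\<^bsub>?Q\<^esub> x" unfolding xy yx using M.a_comm[of u v] u by simp
    fix z assume "z \<in> carrier ?Q"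
    then obtain w where w: "w \<in> carrier M" "z = W +>\<^bsub>M\<^esub> w" by (auto simp: carrier_quotient_space)
    show "(x \<oplus>\<^bsub>?Q\<^esub> y) \<oplus>\<^bsub>?Q\<^esub> z = x \<oplus>\<^bsub>?Q\<^esub> (y \<oplus>\<^bsub>?Q\<^esub> z)"
      using u w M.a_assoc[of u v w] by (simp flip: q(2))
  next
    show "\<zero>\<^bsub>?Q\<^esub> \<in> carrier ?Q" unfolding zero using q(1) by simp
    fix x assume "x \<in> carrier ?Q"
    then obtain u where u: "u \<in> carrier M" "x = W +>\<^bsub>M\<^esub> u" by (auto simp: carrier_quotient_space)
    show "\<zero>\<^bsub>?Q\<^esub> \<oplus>\<^bsub>?Q\<^esub> x = x"
      unfolding u(2) zero q(2)[OF M.M.zero_closed u(1), symmetric] M.M.l_zero[OF u(1)]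
      by (rule refl)
  qed
  show ?thesis
  proof (rule moduleI[OF cring_scalars ab])
    fix c x assume "x \<in> carrier ?Q"
    then show "c \<odot>\<^bsub>?Q\<^esub> x \<in> carrier ?Q"
      using q(3)[symmetric] by (auto simp: carrier_quotient_space)
  next
    fix a b x assume "x \<in> carrier ?Q"
    then obtain u where u: "u \<in> carrier M" "x = W +>\<^bsub>M\<^esub> u" by (auto simp: carrier_quotient_space)
    show "(a \<oplus>\<^bsub>scalars\<^esub> b) \<odot>\<^bsub>?Q\<^esub> x = a \<odot>\<^bsub>?Q\<^esub> x \<oplus>\<^bsub>?Q\<^esub> b \<odot>\<^bsub>?Q\<^esub> x"
      using u M.smult_l_distr[of a b u] by (simp flip: q(2,3))
    show "(a \<otimes>\<^bsub>scalars\<^esub> b) \<odot>\<^bsub>?Q\<^esub> x = a \<odot>\<^bsub>?Q\<^esub> (b \<odot>\<^bsub>?Q\<^esub> x)"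
      using u M.smult_assoc1[of a b u] by (simp flip: q(2,3))
  next
    fix a x y assume "x \<in> carrier ?Q" "y \<in> carrier ?Q"
    then obtain u v where u: "u \<in> carrier M" "x = W +>\<^bsub>M\<^esub> u" "v \<in> carrier M" "y = W +>\<^bsub>M\<^esub> v"
      by (auto simp: carrier_quotient_space)
    show "a \<odot>\<^bsub>?Q\<^esub> (x \<oplus>\<^bsub>?Q\<^esub> y) = a \<odot>\<^bsub>?Q\<^esub> x \<oplus>\<^bsub>?Q\<^esub> a \<odot>\<^bsub>?Q\<^esub> y"
      using u M.smult_r_distr[of a u v] by (simp flip: q(2,3))
  next
    fix x assume "x \<in> carrier ?Q"
    then obtain u where u: "u \<in> carrier M" "x = W +>\<^bsub>M\<^esub> u" by (auto simp: carrier_quotient_space)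
    show "\<one>\<^bsub>scalars\<^esub> \<odot>\<^bsub>?Q\<^esub> x = x"
      using u M.smult_one[of u] by (simp flip: q(2,3))
  qed
qed

text \<open>The map that \<open>h\<close> induces on cosets of a subspace on which it vanishes; there the image of
  a coset is a singleton.\<close>

definition induced_map :: "('v \<Rightarrow> 'w) \<Rightarrow> 'v set \<Rightarrow> 'w" where
  "induced_map h A = the_elem (h ` A)"

lemma induced_map_coset:
  fixes M :: "('f::field, 'v) module" and N :: "('f, 'w) module"
  assumes M: "module scalars M" and W: "submodule W scalars M" and N: "module scalars N"
    and h: "linear_map M N h" and h0: "\<And>w. w \<in> W \<Longrightarrow> h w = \<zero>\<^bsub>N\<^esub>" and x: "x \<in> carrier M"
  shows "induced_map h (W +>\<^bsub>M\<^esub> x) = h x"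
proof -
  interpret N: module scalars N by (rule N)
  note h' = linear_mapD[OF h]
  have "h a = h x" if "a \<in> W +>\<^bsub>M\<^esub> x" for a
    using that x h0 h'(1) h'(2) subspaceD(1)[OF W] by (auto simp: a_r_coset_def')
  then have "h ` (W +>\<^bsub>M\<^esub> x) = {h x}"
    using coset_self[OF M W x] by blast
  then show ?thesis by (simp add: induced_map_def)
qed

lemma linear_map_induced_map:
  fixes M :: "('f::field, 'v) module" and N :: "('f, 'w) module"
  assumes M: "module scalars M" and W: "submodule W scalars M" and N: "module scalars N"
    and h: "linear_map M N h" and h0: "\<And>w. w \<in> W \<Longrightarrow> h w = \<zero>\<^bsub>N\<^esub>"
  shows "linear_map (quotient_space M W) N (induced_map h)"
proof -
  interpret M: module scalars M by (rule M)
  note h' = linear_mapD[OF h] and i = induced_map_coset[OF M W N h h0]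
    and q = linear_mapD[OF linear_map_coset[OF M W]]
  show ?thesis
    unfolding linear_map_def
    by (auto simp: carrier_quotient_space i h' q(2,3)[symmetric])
qed

text \<open>The composition of \<open>h\<close> with the projection onto the quotient by \<open>U\<close> is onto and has
  kernel \<open>W\<close>, so this is an instance of the first isomorphism theorem.\<close>

lemma quotient_space_isomorphicI:
  fixes M :: "('f::field, 'v) module" and N :: "('f, 'w) module"
  assumes M: "module scalars M" and N: "module scalars N" and h: "linear_map M N h"
    and surj: "carrier N \<subseteq> h ` carrier M"
    and U: "submodule U scalars N" and W: "W = {x \<in> carrier M. h x \<in> U}"
  shows "quotient_space M W \<cong>\<^sub>v quotient_space N U"
proof -
  interpret M: module scalars M by (rule M)
  interpret N: module scalars N by (rule N)
  interpret U: abelian_subgroup U N by (rule abelian_subgroup_subspace[OF N U])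
  have W': "submodule W scalars M" unfolding W by (rule subspace_vimage[OF M N h U])
  let ?k = "\<lambda>x. U +>\<^bsub>N\<^esub> h x"
  have Q: "module scalars (quotient_space N U)" by (rule module_quotient_space[OF N U])
  have k: "linear_map M (quotient_space N U) ?k"
    by (rule linear_map_comp[OF h linear_map_coset[OF N U]])
  have k0: "?k w = \<zero>\<^bsub>quotient_space N U\<^esub>" if "w \<in> W" for w
    using that U.a_rcos_const by (auto simp: W quotient_space_def)
  note i = induced_map_coset[OF M W' Q k k0]
  note lin = linear_mapD[OF linear_map_induced_map[OF M W' Q k k0]]
  have "inj_on (induced_map ?k) (carrier (quotient_space M W))"
  proof (rule inj_onI)
    fix A B assume "A \<in> carrier (quotient_space M W)" "B \<in> carrier (quotient_space M W)"
      and eq: "induced_map ?k A = induced_map ?k B"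
    then obtain x y where x: "x \<in> carrier M" "A = W +>\<^bsub>M\<^esub> x" and y: "y \<in> carrier M" "B = W +>\<^bsub>M\<^esub> y"
      by (auto simp: carrier_quotient_space)
    from eq have "U +>\<^bsub>N\<^esub> h x = U +>\<^bsub>N\<^esub> h y" by (simp add: x y i)
    then obtain u where u: "u \<in> U" "h x = u \<oplus>\<^bsub>N\<^esub> h y"
      using coset_eq_iff[OF N U] linear_mapD(1)[OF h] x y by blast
    have hxy: "h x \<in> carrier N" "h y \<in> carrier N" "u \<in> carrier N"
      using linear_mapD(1)[OF h] x y u by auto
    have xy: "x \<ominus>\<^bsub>M\<^esub> y \<in> carrier M" using x y by simp
    have x': "x = (x \<ominus>\<^bsub>M\<^esub> y) \<oplus>\<^bsub>M\<^esub> y"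
      using x y by (simp add: a_minus_def M.a_assoc M.l_neg)
    then have "h x = h (x \<ominus>\<^bsub>M\<^esub> y) \<oplus>\<^bsub>N\<^esub> h y"
      using linear_mapD(2)[OF h xy y(1)] by simp
    then have "h (x \<ominus>\<^bsub>M\<^esub> y) = u"
      using u hxy linear_mapD(1)[OF h xy] N.add.r_cancel by metis
    then have "x \<ominus>\<^bsub>M\<^esub> y \<in> W" using xy u by (simp add: W)
    then show "A = B" unfolding x(2) y(2) using coset_eq_iff[OF M W' x(1) y(1)] x' by blast
  qed
  moreover have "induced_map ?k ` carrier (quotient_space M W) = carrier (quotient_space N U)"
    using surj linear_mapD(1)[OF h] by (force simp: carrier_quotient_space image_image i)
  ultimately have "induced_map ?k \<in> iso (add_monoid (quotient_space M W)) (add_monoid (quotient_space N U))"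
    using lin by (auto simp: iso_def hom_def bij_betw_def)
  then show ?thesis
    unfolding vs_isomorphic_def using lin(3) by blast
qed

lemma subspace_Int:
  fixes M :: "('f::field, 'v) module"
  assumes M: "module scalars M" and "submodule H scalars M" "submodule H' scalars M"
  shows "submodule (H \<inter> H') scalars M"
  by (rule subspaceI[OF M]) (use subspaceD[OF assms(2)] subspaceD[OF assms(3)] in auto)

text \<open>The union is of the kind that defines \<open>reg_boundary\<close>; all its members coincide because \<open>h\<close> maps
  \<open>W\<close> into \<open>U\<close>.\<close>

lemma UN_coset_linear_map:
  fixes M :: "('f::field, 'v) module" and N :: "('f, 'w) module"
  assumes M: "module scalars M" and W: "submodule W scalars M"
    and N: "module scalars N" and U: "submodule U scalars N"
    and h: "linear_map M N h" and hW: "\<And>w. w \<in> W \<Longrightarrow> h w \<in> U" and x: "x \<in> carrier M"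
  shows "(\<Union>a \<in> W +>\<^bsub>M\<^esub> x. U +>\<^bsub>N\<^esub> h a) = U +>\<^bsub>N\<^esub> h x"
proof -
  have "U +>\<^bsub>N\<^esub> h a = U +>\<^bsub>N\<^esub> h x" if a: "a \<in> W +>\<^bsub>M\<^esub> x" for a
  proof -
    obtain w where w: "w \<in> W" "a = w \<oplus>\<^bsub>M\<^esub> x" using a by (auto simp: a_r_coset_def')
    then have "w \<in> carrier M" using subspaceD(1)[OF W] by blast
    then have "h a \<in> carrier N" "h a = h w \<oplus>\<^bsub>N\<^esub> h x"
      using w x linear_mapD[OF h] subspaceD(1)[OF U] hW[OF w(1)]
        abelian_monoid.a_closed[OF abelian_group.axioms(1)[OF module.axioms(2)[OF N]]] by auto
    then show ?thesis using hW[OF w(1)] coset_eq_iff[OF N U] linear_mapD(1)[OF h x] by blast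
  qed
  then show ?thesis by (intro UN_constant_eq[OF coset_self[OF M W x]]) blast
qed

lemma coset_eq_zero_iff:
  fixes M :: "('f::field, 'v) module"
  assumes M: "module scalars M" and W: "submodule W scalars M" and x: "x \<in> carrier M"
  shows "W +>\<^bsub>M\<^esub> x = W \<longleftrightarrow> x \<in> W"
proof -
  interpret W: abelian_subgroup W M by (rule abelian_subgroup_subspace[OF M W])
  show ?thesis using W.a_rcos_const W.a_rcos_self[OF x] by auto
qed

section \<open>Function spaces\<close>

lemma fun_space_simps [simp]:
  "f \<in> carrier (fun_space S) \<longleftrightarrow> (\<forall>s. s \<notin> S \<longrightarrow> f s = 0)"
  "\<zero>\<^bsub>fun_space S\<^esub> = (\<lambda>_. 0)"
  "f \<oplus>\<^bsub>fun_space S\<^esub> g = (\<lambda>s. f s + g s)"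
  "c \<odot>\<^bsub>fun_space S\<^esub> f = (\<lambda>s. c * f s)"
  by (simp_all add: fun_space_def)

lemma module_fun_space: "module scalars (fun_space S :: ('f::field, 's \<Rightarrow> 'f) module)"
proof (rule moduleI[OF cring_scalars])
  show "abelian_group (fun_space S :: ('f, 's \<Rightarrow> 'f) module)"
  proof (rule abelian_groupI)
    fix f :: "'s \<Rightarrow> 'f" assume "f \<in> carrier (fun_space S)"
    then show "\<exists>g \<in> carrier (fun_space S). g \<oplus>\<^bsub>fun_space S\<^esub> f = \<zero>\<^bsub>fun_space S\<^esub>"
      by (intro bexI[of _ "\<lambda>s. - f s"]) auto
  qed (auto simp: algebra_simps)
qed (auto simp: algebra_simps)

lemma subspace_fun_spaceI:
  fixes H :: "('s \<Rightarrow> 'f::field) set"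
  assumes "\<And>f s. f \<in> H \<Longrightarrow> s \<notin> S \<Longrightarrow> f s = 0" "(\<lambda>_. 0) \<in> H"
    and "\<And>f g. f \<in> H \<Longrightarrow> g \<in> H \<Longrightarrow> (\<lambda>s. f s + g s) \<in> H"
    and "\<And>c f. f \<in> H \<Longrightarrow> (\<lambda>s. c * f s) \<in> H"
  shows "submodule H scalars (fun_space S)"
  by (rule subspaceI[OF module_fun_space]) (use assms in auto)

lemma subspace_carrier_fun_space:
  assumes "T \<subseteq> S"
  shows "submodule (carrier (fun_space T)) scalars (fun_space S :: ('f::field, 's \<Rightarrow> 'f) module)"
  by (rule subspace_fun_spaceI) (use assms in auto)

lemma subspace_sum:
  fixes H :: "('s \<Rightarrow> 'f::field) set"
  assumes H: "submodule H scalars (fun_space S)"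
    and I: "finite I" "\<And>i. i \<in> I \<Longrightarrow> c i \<noteq> 0 \<Longrightarrow> v i \<in> H"
  shows "(\<lambda>s. \<Sum>i\<in>I. c i * v i s) \<in> H"
  using I
proof (induction rule: finite_induct)
  case empty
  then show ?case using subspaceD(2)[OF H] by simp
next
  case (insert i I)
  have "(\<lambda>s. c i * v i s) \<in> H"
    using insert.prems[of i] subspaceD(2,4)[OF H] by (cases "c i = 0") auto
  then show ?case
    using insert subspaceD(3)[OF H, of "\<lambda>s. c i * v i s" "\<lambda>s. \<Sum>i\<in>I. c i * v i s"] by simp
qed

text \<open>This turns membership in the spans of path homology into a condition on the support of a
  function.\<close>

lemma lin_span_basis_vec:
  assumes "finite S" "T \<subseteq> S"
  shows "lin_span (fun_space S) (basis_vec ` T) = carrier (fun_space T :: ('f::field, 's \<Rightarrow> 'f) module)"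
proof
  let ?B = "basis_vec ` T :: ('s \<Rightarrow> 'f) set"
  have B: "?B \<subseteq> carrier (fun_space T)" by (auto simp: basis_vec_def)
  show "lin_span (fun_space S) ?B \<subseteq> carrier (fun_space T)"
    by (rule lin_span_minimal[OF B subspace_carrier_fun_space[OF assms(2)]])
  have span: "submodule (lin_span (fun_space S) ?B) scalars (fun_space S)"
    by (rule subspace_lin_span[OF module_fun_space]) (use assms(2) in \<open>auto simp: basis_vec_def\<close>)
  show "carrier (fun_space T) \<subseteq> lin_span (fun_space S) ?B"
  proof
    fix f :: "'s \<Rightarrow> 'f" assume f: "f \<in> carrier (fun_space T)"
    have fin: "finite T" using assms finite_subset by blast
    have "(\<lambda>s. \<Sum>t\<in>T. f t * basis_vec t s) \<in> lin_span (fun_space S) ?B"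
      by (rule subspace_sum[OF span fin]) (use lin_span_superset[of ?B] in blast)
    moreover have "(\<lambda>s. \<Sum>t\<in>T. f t * basis_vec t s) = f"
      using f fin by (auto simp: basis_vec_def if_distrib sum.delta' cong: if_cong)
    ultimately show "f \<in> lin_span (fun_space S) ?B" by simp
  qed
qed

section \<open>Elementary paths\<close>

definition irregular_paths :: "'a pair_pre_digraph \<Rightarrow> int \<Rightarrow> 'a list set" where
  "irregular_paths G m = {xs \<in> elem_paths G m. \<exists>k. Suc k < length xs \<and> xs ! k = xs ! Suc k}"

definition allowed_paths :: "'a pair_pre_digraph \<Rightarrow> int \<Rightarrow> 'a list set" where
  "allowed_paths G m =
     {xs \<in> elem_paths G m. \<forall>k. Suc k < length xs \<longrightarrow> (xs ! k, xs ! Suc k) \<in> parcs G}"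

abbreviation path_coset ::
    "'a pair_pre_digraph \<Rightarrow> int \<Rightarrow> ('a list \<Rightarrow> 'f::field) \<Rightarrow> ('a list \<Rightarrow> 'f) set" where
  "path_coset G m f \<equiv> irregular_space G m +>\<^bsub>\<Lambda> G m\<^esub> f"

lemma irregular_paths_subset: "irregular_paths G m \<subseteq> elem_paths G m"
  and allowed_paths_subset: "allowed_paths G m \<subseteq> elem_paths G m"
  by (auto simp: irregular_paths_def allowed_paths_def)

lemma finite_elem_paths:
  assumes "finite (pverts G)"
  shows "finite (elem_paths G m)"
proof (rule finite_subset)
  show "elem_paths G m \<subseteq> {xs. set xs \<subseteq> pverts G \<and> length xs = nat (m + 1)}"
    by (auto simp: elem_paths_def)
  show "finite {xs. set xs \<subseteq> pverts G \<and> length xs = nat (m + 1)}"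
    using finite_lists_length_eq[OF assms] by simp
qed

lemma ex_consecutive_2: "(\<exists>k. Suc k < length [x, y] \<and> P ([x, y] ! k) ([x, y] ! Suc k)) \<longleftrightarrow> P x y"
  by auto

lemma ex_consecutive_3:
  "(\<exists>k. Suc k < length [x, y, z] \<and> P ([x, y, z] ! k) ([x, y, z] ! Suc k)) \<longleftrightarrow> P x y \<or> P y z"
  by (auto simp: less_Suc_eq intro: exI[of _ 0] exI[of _ "Suc 0"])

lemma elem_paths_0 [simp]: "elem_paths G 0 = (\<lambda>x. [x]) ` pverts G"
  by (auto simp: elem_paths_def length_Suc_conv)

lemma elem_paths_1: "elem_paths G 1 = (\<lambda>(x, y). [x, y]) ` (pverts G \<times> pverts G)"
proof -
  have "int (length xs) = 2 \<longleftrightarrow> (\<exists>x y. xs = [x, y])" for xs :: "'a list"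
    by (auto simp: length_Suc_conv numeral_2_eq_2 of_nat_eq_iff[of _ 2, where 'a = int, simplified])
  then show ?thesis by (force simp: elem_paths_def)
qed

lemma elem_paths_2:
  "elem_paths G 2 = (\<lambda>(x, y, z). [x, y, z]) ` (pverts G \<times> pverts G \<times> pverts G)"
proof -
  have "int (length xs) = 3 \<longleftrightarrow> (\<exists>x y z. xs = [x, y, z])" for xs :: "'a list"
    by (auto simp: length_Suc_conv numeral_3_eq_3 of_nat_eq_iff[of _ 3, where 'a = int, simplified])
  then show ?thesis by (force simp: elem_paths_def)
qed

lemma irregular_paths_0: "irregular_paths G 0 = {}"
  by (auto simp: irregular_paths_def)

lemma allowed_paths_0: "allowed_paths G 0 = elem_paths G 0"
  by (auto simp: allowed_paths_def)

lemma irregular_paths_1: "[x, y] \<in> irregular_paths G 1 \<longleftrightarrow> x \<in> pverts G \<and> x = y"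
  unfolding irregular_paths_def mem_Collect_eq ex_consecutive_2 by (auto simp: elem_paths_def)

lemma irregular_paths_2:
  "[x, y, z] \<in> irregular_paths G 2 \<longleftrightarrow> {x, y, z} \<subseteq> pverts G \<and> (x = y \<or> y = z)"
  unfolding irregular_paths_def mem_Collect_eq ex_consecutive_3 by (auto simp: elem_paths_def)

lemma allowed_paths_1:
  "[x, y] \<in> allowed_paths G 1 \<longleftrightarrow> {x, y} \<subseteq> pverts G \<and> (x, y) \<in> parcs G"
  using ex_consecutive_2[of x y "\<lambda>u v. (u, v) \<notin> parcs G"]
  unfolding allowed_paths_def mem_Collect_eq by (auto simp: elem_paths_def)

lemma allowed_paths_2:
  "[x, y, z] \<in> allowed_paths G 2 \<longleftrightarrow>
     {x, y, z} \<subseteq> pverts G \<and> (x, y) \<in> parcs G \<and> (y, z) \<in> parcs G"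
  using ex_consecutive_3[of x y z "\<lambda>u v. (u, v) \<notin> parcs G"]
  unfolding allowed_paths_def mem_Collect_eq by (auto simp: elem_paths_def)

lemma sum_elem_paths_1: "(\<Sum>xs \<in> elem_paths G 1. F xs) = (\<Sum>x\<in>pverts G. \<Sum>y\<in>pverts G. F [x, y])"
  unfolding elem_paths_1
  by (subst sum.reindex) (auto simp: inj_on_def sum.cartesian_product case_prod_unfold)

lemma sum_elem_paths_2:
  "(\<Sum>xs \<in> elem_paths G 2. F xs) = (\<Sum>x\<in>pverts G. \<Sum>y\<in>pverts G. \<Sum>z\<in>pverts G. F [x, y, z])"
  unfolding elem_paths_2
  by (subst sum.reindex) (auto simp: inj_on_def sum.cartesian_product case_prod_unfold)

section \<open>Regular and allowed chains\<close>

lemma module_path_space: "module scalars (\<Lambda> G m :: ('f::field, 'a list \<Rightarrow> 'f) module)"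
  unfolding path_space_def by (rule module_fun_space)

lemma irregular_space_eq:
  assumes "finite (pverts G)"
  shows "irregular_space G m = carrier (fun_space (irregular_paths G m) :: ('f::field, 'a list \<Rightarrow> 'f) module)"
proof -
  have "{basis_vec xs :: 'a list \<Rightarrow> 'f | xs. xs \<in> elem_paths G m \<and>
      (\<exists>k. Suc k < length xs \<and> xs ! k = xs ! Suc k)} = basis_vec ` irregular_paths G m"
    by (auto simp: irregular_paths_def)
  then show ?thesis
    unfolding irregular_space_def path_space_def
    using lin_span_basis_vec[OF finite_elem_paths[OF assms] irregular_paths_subset] by metis
qed

lemma subspace_irregular_space:
  assumes "finite (pverts G)"
  shows "submodule (irregular_space G m :: ('a list \<Rightarrow> 'f::field) set) scalars (\<Lambda> G m)"
  unfolding irregular_space_eq[OF assms] path_space_def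
  by (rule subspace_carrier_fun_space[OF irregular_paths_subset])

lemma module_regular_space:
  assumes "finite (pverts G)"
  shows "module scalars (regular_space G m :: ('f::field, ('a list \<Rightarrow> 'f) set) module)"
  unfolding regular_space_def
  by (rule module_quotient_space[OF module_path_space subspace_irregular_space[OF assms]])

lemma linear_map_path_coset:
  assumes "finite (pverts G)"
  shows "linear_map (\<Lambda> G m) (regular_space G m) (path_coset G m :: ('a list \<Rightarrow> 'f::field) \<Rightarrow> _)"
  unfolding regular_space_def
  by (rule linear_map_coset[OF module_path_space subspace_irregular_space[OF assms]])

text \<open>An element of the allowed space is a coset; it has a unique representative supported on
  allowed paths if the graph has no loops, and the arguments below work with that representative.\<close>

lemma allowed_space_eq:
  assumes "finite (pverts G)"
  shows "allowed_space G m = path_coset G m ` carrier (fun_space (allowed_paths G m) :: ('f::field, 'a list \<Rightarrow> 'f) module)"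
proof -
  let ?B = "basis_vec ` allowed_paths G m :: ('a list \<Rightarrow> 'f) set"
  have "{path_coset G m (basis_vec xs :: 'a list \<Rightarrow> 'f) | xs. xs \<in> elem_paths G m \<and>
      (\<forall>k. Suc k < length xs \<longrightarrow> (xs ! k, xs ! Suc k) \<in> parcs G)} = path_coset G m ` ?B"
    by (auto simp: allowed_paths_def)
  then have "allowed_space G m = lin_span (regular_space G m) (path_coset G m ` ?B)"
    unfolding allowed_space_def by simp
  also have "\<dots> = path_coset G m ` lin_span (\<Lambda> G m) ?B"
    by (rule lin_span_image[OF module_path_space module_regular_space[OF assms]
          linear_map_path_coset[OF assms]])
      (use allowed_paths_subset[of G m] in \<open>auto simp: path_space_def basis_vec_def\<close>)
  finally show ?thesis
    unfolding path_space_def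
    using lin_span_basis_vec[OF finite_elem_paths[OF assms] allowed_paths_subset] by metis
qed

lemma path_coset_eq_iff:
  fixes f g :: "'a list \<Rightarrow> 'f::field"
  assumes fin: "finite (pverts G)" and f: "f \<in> carrier (\<Lambda> G m)" and g: "g \<in> carrier (\<Lambda> G m)"
  shows "path_coset G m f = path_coset G m g \<longleftrightarrow> (\<forall>xs. xs \<notin> irregular_paths G m \<longrightarrow> f xs = g xs)"
proof -
  have "path_coset G m f = path_coset G m g \<longleftrightarrow>
      (\<exists>w \<in> carrier (fun_space (irregular_paths G m)). f = (\<lambda>xs. w xs + g xs))"
    using coset_eq_iff[OF module_path_space subspace_irregular_space[OF fin] f g]
    unfolding irregular_space_eq[OF fin] by (simp add: path_space_def)
  also have "\<dots> \<longleftrightarrow> (\<forall>xs. xs \<notin> irregular_paths G m \<longrightarrow> f xs = g xs)"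
    by (auto intro!: bexI[of _ "\<lambda>xs. f xs - g xs"])
  finally show ?thesis .
qed

section \<open>The boundary map in degrees one and two\<close>

lemma boundary_eq_sum:
  assumes fin: "finite (pverts G)" and m: "m > 0" and f: "f \<in> carrier (\<Lambda> G m)"
  shows "boundary m f ys = (\<Sum>xs\<in>elem_paths G m. f xs *
    (\<Sum>k < length xs. (- 1) ^ k * basis_vec (take k xs @ drop (Suc k) xs) ys))"
  unfolding boundary_def using m f
  by (auto simp: path_space_def intro!: sum.mono_neutral_left finite_elem_paths[OF fin])

text \<open>The definition of \<open>boundary\<close> sums over the support of its argument, which hides linearity;
  on a finite graph the sum may be extended to all elementary paths.\<close>

lemma linear_map_boundary:
  assumes fin: "finite (pverts G)" and m: "m > 0"
  shows "linear_map (\<Lambda> G m) (\<Lambda> G (m - 1)) (boundary m :: ('a list \<Rightarrow> 'f::field) \<Rightarrow> _)"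
proof -
  note eq = boundary_eq_sum[OF fin m]
  have "boundary m f ys = 0" if "f \<in> carrier (\<Lambda> G m)" "ys \<notin> elem_paths G (m - 1)"
    for f :: "'a list \<Rightarrow> 'f" and ys
  proof -
    have "ys \<noteq> take k xs @ drop (Suc k) xs" if "xs \<in> elem_paths G m" "k < length xs" for xs k
      using that m \<open>ys \<notin> elem_paths G (m - 1)\<close>
      by (auto simp: elem_paths_def dest!: in_set_takeD in_set_dropD)
    then show ?thesis
      unfolding eq[OF that(1)] by (auto simp: basis_vec_def intro!: sum.neutral)
  qed
  moreover have "(\<lambda>s. f s + g s) \<in> carrier (\<Lambda> G m)" "(\<lambda>s. c * f s) \<in> carrier (\<Lambda> G m)"
    if "f \<in> carrier (\<Lambda> G m)" "g \<in> carrier (\<Lambda> G m)" for f g :: "'a list \<Rightarrow> 'f" and c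
    using that by (auto simp: path_space_def)
  ultimately show ?thesis
    unfolding linear_map_def
    by (auto simp: path_space_def fun_eq_iff eq[unfolded path_space_def] algebra_simps
        sum.distrib sum_distrib_left)
qed

lemmas linear_map_boundary_1 = linear_map_boundary[where m = 1, simplified]
  and linear_map_boundary_2 = linear_map_boundary[where m = 2, simplified]

lemma boundary_1_sum:
  assumes fin: "finite (pverts G)" and f: "f \<in> carrier (\<Lambda> G 1)"
  shows "boundary 1 f ys =
    (\<Sum>x\<in>pverts G. \<Sum>y\<in>pverts G. f [x, y] * (basis_vec [y] ys - basis_vec [x] ys))"
  by (simp add: boundary_eq_sum[OF fin _ f] sum_elem_paths_1)

lemma boundary_2_sum:
  assumes fin: "finite (pverts G)" and f: "f \<in> carrier (\<Lambda> G 2)"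
  shows "boundary 2 f ys = (\<Sum>x\<in>pverts G. \<Sum>y\<in>pverts G. \<Sum>z\<in>pverts G.
    f [x, y, z] * (basis_vec [y, z] ys - basis_vec [x, z] ys + basis_vec [x, y] ys))"
  by (simp add: boundary_eq_sum[OF fin _ f] sum_elem_paths_2)

lemma boundary_1_apply:
  assumes fin: "finite (pverts G)" and f: "f \<in> carrier (\<Lambda> G 1)" and a: "a \<in> pverts G"
  shows "boundary 1 f [a] = (\<Sum>c\<in>pverts G. f [c, a] - f [a, c])"
proof -
  have *: "f [x, y] * (basis_vec [y] [a] - basis_vec [x] [a]) =
      (if a = y then f [x, a] else 0) - (if a = x then f [a, y] else 0)" for x y
    by (auto simp: basis_vec_def)
  have **: "(\<Sum>y\<in>pverts G. if a = x then f [a, y] else 0) =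
      (if a = x then \<Sum>y\<in>pverts G. f [a, y] else 0)" for x
    by simp
  show ?thesis
    unfolding boundary_1_sum[OF fin f] * sum_subtractf ** using fin a by (simp add: sum.delta)
qed

text \<open>The three terms come from the paths from which \<open>[a, b]\<close> arises by omitting the first, the
  middle and the last vertex.\<close>

lemma boundary_2_apply:
  assumes fin: "finite (pverts G)" and f: "f \<in> carrier (\<Lambda> G 2)"
    and a: "a \<in> pverts G" and b: "b \<in> pverts G"
  shows "boundary 2 f [a, b] = (\<Sum>c\<in>pverts G. f [c, a, b] - f [a, c, b] + f [a, b, c])"
proof -
  have *: "f [x, y, z] * (basis_vec [y, z] [a, b] - basis_vec [x, z] [a, b] + basis_vec [x, y] [a, b]) =
      (if a = y then if b = z then f [x, a, b] else 0 else 0)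
      - (if a = x then if b = z then f [a, y, b] else 0 else 0)
      + (if a = x then if b = y then f [a, b, z] else 0 else 0)" for x y z
    by (auto simp: basis_vec_def)
  have **: "(\<Sum>y\<in>pverts G. if P then F y else 0) = (if P then \<Sum>y\<in>pverts G. F y else 0)"
    for P and F :: "'a \<Rightarrow> 'b" by simp
  show ?thesis
    unfolding boundary_2_sum[OF fin f] * sum_subtractf sum.distrib ** using fin a b
    by (simp add: sum.delta)
qed

text \<open>The boundary descends to regular chains because the faces of \<open>[x, x]\<close>, and the two equal
  faces of \<open>[x, x, y]\<close> and of \<open>[x, y, y]\<close>, cancel; the third face is again irregular.\<close>

lemma boundary_irregular_1:
  assumes fin: "finite (pverts G)" and f: "f \<in> irregular_space G 1"
  shows "boundary 1 f \<in> irregular_space G 0"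
proof -
  have f0: "f xs = 0" if "xs \<notin> irregular_paths G 1" for xs
    using f that by (simp add: irregular_space_eq[OF fin])
  have f': "f \<in> carrier (\<Lambda> G 1)" using subspaceD(1)[OF subspace_irregular_space[OF fin]] f by blast
  have "boundary 1 f xs = 0" for xs
  proof (cases "xs \<in> elem_paths G 0")
    case True
    then obtain a where a: "a \<in> pverts G" "xs = [a]" by auto
    have "f [c, a] - f [a, c] = 0" for c
      by (cases "c = a") (auto simp: f0 irregular_paths_1)
    then show ?thesis using boundary_1_apply[OF fin f' a(1)] a(2) by simp
  next
    case False
    then show ?thesis using linear_mapD(1)[OF linear_map_boundary[OF fin, of 1] f']
      by (simp add: path_space_def)
  qed
  then show ?thesis by (simp add: irregular_space_eq[OF fin])
qed

lemma boundary_irregular_2: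
  assumes fin: "finite (pverts G)" and f: "f \<in> irregular_space G 2"
  shows "boundary 2 f \<in> irregular_space G 1"
proof -
  have f0: "f xs = 0" if "xs \<notin> irregular_paths G 2" for xs
    using f that by (simp add: irregular_space_eq[OF fin])
  have f': "f \<in> carrier (\<Lambda> G 2)" using subspaceD(1)[OF subspace_irregular_space[OF fin]] f by blast
  have "boundary 2 f xs = 0" if "xs \<notin> irregular_paths G 1" for xs
  proof (cases "xs \<in> elem_paths G 1")
    case True
    then obtain a b where a: "a \<in> pverts G" "b \<in> pverts G" "xs = [a, b]" by (auto simp: elem_paths_1)
    then have "a \<noteq> b" using that by (auto simp: irregular_paths_1)
    then have "f [c, a, b] - f [a, c, b] + f [a, b, c] = 0" for c
      by (cases "c = a"; cases "c = b") (auto simp: f0 irregular_paths_2)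
    then show ?thesis using boundary_2_apply[OF fin f' a(1,2)] a(3) by simp
  next
    case False
    then show ?thesis using linear_mapD(1)[OF linear_map_boundary[OF fin, of 2] f']
      by (simp add: path_space_def)
  qed
  then show ?thesis by (simp add: irregular_space_eq[OF fin])
qed

lemma reg_boundary_1:
  assumes fin: "finite (pverts G)" and f: "f \<in> carrier (\<Lambda> G 1)"
  shows "reg_boundary G 1 (path_coset G 1 f) = path_coset G 0 (boundary 1 f)"
  using UN_coset_linear_map[OF module_path_space subspace_irregular_space[OF fin]
      module_path_space subspace_irregular_space[OF fin] linear_map_boundary_1[OF fin]
      boundary_irregular_1[OF fin] f]
  by (simp add: reg_boundary_def)

lemma reg_boundary_2:
  assumes fin: "finite (pverts G)" and f: "f \<in> carrier (\<Lambda> G 2)"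
  shows "reg_boundary G 2 (path_coset G 2 f) = path_coset G 1 (boundary 2 f)"
  using UN_coset_linear_map[OF module_path_space subspace_irregular_space[OF fin]
      module_path_space subspace_irregular_space[OF fin] linear_map_boundary_2[OF fin]
      boundary_irregular_2[OF fin] f]
  by (simp add: reg_boundary_def)

section \<open>The cycle space, triangles and squares\<close>

lemma pair_graphD:
  assumes "pair_graph G"
  shows "finite (pverts G)" "(x, y) \<in> parcs G \<Longrightarrow> x \<in> pverts G" "(x, y) \<in> parcs G \<Longrightarrow> y \<in> pverts G"
    "(x, x) \<notin> parcs G" "(x, y) \<in> parcs G \<Longrightarrow> (y, x) \<in> parcs G" "finite {y. (x, y) \<in> parcs G}"
    "(x, y) \<in> parcs G \<longleftrightarrow> (y, x) \<in> parcs G" "(x, y) \<in> parcs G \<Longrightarrow> x \<noteq> y"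
proof -
  interpret pair_graph G by (rule assms)
  show fin: "finite (pverts G)" by (rule pair_finite_verts)
  show "(x, y) \<in> parcs G \<Longrightarrow> x \<in> pverts G" "(x, y) \<in> parcs G \<Longrightarrow> y \<in> pverts G"
    by (auto dest: in_arcsD1 in_arcsD2)
  show "(x, x) \<notin> parcs G" "(x, y) \<in> parcs G \<Longrightarrow> x \<noteq> y" using pair_no_loops by fastforce+
  show "(x, y) \<in> parcs G \<Longrightarrow> (y, x) \<in> parcs G" "(x, y) \<in> parcs G \<longleftrightarrow> (y, x) \<in> parcs G"
    using pair_sym_arcs unfolding symmetric_def sym_def by auto
  show "finite {y. (x, y) \<in> parcs G}"
    by (rule finite_subset[OF _ fin]) (auto dest: in_arcsD2)
qed

lemma cycle_space_simps [simp]: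
  "\<zero>\<^bsub>cycle_space G\<^esub> = (\<lambda>_. 0)"
  "f \<oplus>\<^bsub>cycle_space G\<^esub> g = (\<lambda>s. f s + g s)"
  "c \<odot>\<^bsub>cycle_space G\<^esub> f = (\<lambda>s. c * f s)"
  by (simp_all add: cycle_space_def)

lemma carrier_cycle_space:
  "\<phi> \<in> carrier (cycle_space G) \<longleftrightarrow> (\<forall>s. s \<notin> parcs G \<longrightarrow> \<phi> s = 0) \<and>
     (\<forall>x y. (x, y) \<in> parcs G \<longrightarrow> \<phi> (x, y) = - \<phi> (y, x)) \<and>
     (\<forall>x \<in> pverts G. (\<Sum>y | (x, y) \<in> parcs G. \<phi> (x, y)) = 0)"
  by (simp add: cycle_space_def)

lemma cycle_spaceD:
  assumes "\<phi> \<in> carrier (cycle_space G)"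
  shows "s \<notin> parcs G \<Longrightarrow> \<phi> s = 0" "(x, y) \<in> parcs G \<Longrightarrow> \<phi> (x, y) = - \<phi> (y, x)"
    "x \<in> pverts G \<Longrightarrow> (\<Sum>y | (x, y) \<in> parcs G. \<phi> (x, y)) = 0"
proof -
  note * = assms[unfolded carrier_cycle_space]
  show "s \<notin> parcs G \<Longrightarrow> \<phi> s = 0" "(x, y) \<in> parcs G \<Longrightarrow> \<phi> (x, y) = - \<phi> (y, x)"
    "x \<in> pverts G \<Longrightarrow> (\<Sum>y | (x, y) \<in> parcs G. \<phi> (x, y)) = 0"
    by (rule *[THEN conjunct1, rule_format] *[THEN conjunct2, THEN conjunct1, rule_format]
        *[THEN conjunct2, THEN conjunct2, rule_format]; assumption)+
qed

lemma cycle_spaceI: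
  assumes "\<And>s. s \<notin> parcs G \<Longrightarrow> \<phi> s = 0" "\<And>x y. (x, y) \<in> parcs G \<Longrightarrow> \<phi> (x, y) = - \<phi> (y, x)"
    and "\<And>x. x \<in> pverts G \<Longrightarrow> (\<Sum>y | (x, y) \<in> parcs G. \<phi> (x, y)) = 0"
  shows "\<phi> \<in> carrier (cycle_space G)"
  unfolding carrier_cycle_space by (intro conjI allI impI ballI) (rule assms; assumption)+

lemma subspace_cycle_space:
  "submodule (carrier (cycle_space G)) scalars (fun_space (parcs G) :: ('f::field, 'a \<times> 'a \<Rightarrow> 'f) module)"
proof (rule subspace_fun_spaceI)
  fix f g :: "'a \<times> 'a \<Rightarrow> 'f" and c
  assume f: "f \<in> carrier (cycle_space G)"
  show "s \<notin> parcs G \<Longrightarrow> f s = 0" for s by (rule cycle_spaceD[OF f])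
  show "(\<lambda>s. c * f s) \<in> carrier (cycle_space G)"
  proof (rule cycle_spaceI)
    show "c * f (x, y) = - (c * f (y, x))" if "(x, y) \<in> parcs G" for x y
      by (simp add: cycle_spaceD(2)[OF f that])
  qed (simp_all add: cycle_spaceD(1,3)[OF f] flip: sum_distrib_left)
  assume g: "g \<in> carrier (cycle_space G)"
  show "(\<lambda>s. f s + g s) \<in> carrier (cycle_space G)"
  proof (rule cycle_spaceI)
    show "f (x, y) + g (x, y) = - (f (y, x) + g (y, x))" if "(x, y) \<in> parcs G" for x y
      by (simp add: cycle_spaceD(2)[OF f that] cycle_spaceD(2)[OF g that])
  qed (simp_all add: cycle_spaceD(1,3)[OF f] cycle_spaceD(1,3)[OF g] sum.distrib)
next
  show "(\<lambda>_. 0) \<in> carrier (cycle_space G)" by (rule cycle_spaceI) simp_all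
qed

lemma module_cycle_space: "module scalars (cycle_space G :: ('f::field, 'a \<times> 'a \<Rightarrow> 'f) module)"
proof -
  have "cycle_space G = (fun_space (parcs G))\<lparr>carrier := carrier (cycle_space G :: ('f, _) module)\<rparr>"
    by (simp add: cycle_space_def)
  then show ?thesis
    using submodule.submodule_is_module[OF subspace_cycle_space[of G] module_fun_space] by metis
qed

text \<open>The antisymmetric function of a single arc. Circuit vectors of length three and four are
  sums of these.\<close>

definition arc_vec :: "'a \<Rightarrow> 'a \<Rightarrow> 'a \<times> 'a \<Rightarrow> 'f::field" where
  "arc_vec x y = (\<lambda>s. basis_vec (x, y) s - basis_vec (y, x) s)"

lemma circuit_arcs_3: "circuit_arcs [x, y, z] = {(x, y), (y, z), (z, x)}"
proof -
  have "{..<length [x, y, z]} = {0, 1, 2}" by auto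
  then have "circuit_arcs [x, y, z] =
      (\<lambda>i. ([x, y, z] ! i, [x, y, z] ! (Suc i mod length [x, y, z]))) ` {0, 1, 2}"
    unfolding circuit_arcs_def by blast
  then show ?thesis by simp
qed

lemma circuit_arcs_4: "circuit_arcs [x, y, z, w] = {(x, y), (y, z), (z, w), (w, x)}"
proof -
  have "{..<length [x, y, z, w]} = {0, 1, 2, 3}" by auto
  then have "circuit_arcs [x, y, z, w] =
      (\<lambda>i. ([x, y, z, w] ! i, [x, y, z, w] ! (Suc i mod length [x, y, z, w]))) ` {0, 1, 2, 3}"
    unfolding circuit_arcs_def by blast
  then show ?thesis by simp
qed

lemma circuit_vec_3:
  assumes "distinct [x, y, z]"
  shows "circuit_vec [x, y, z] = (\<lambda>s. arc_vec x y s + arc_vec y z s + arc_vec z x s)"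
proof
  fix s :: "'a \<times> 'a"
  obtain a b where "s = (a, b)" by (cases s)
  then show "circuit_vec [x, y, z] s = arc_vec x y s + arc_vec y z s + arc_vec z x s"
    using assms
    by (cases "a = x"; cases "a = y"; cases "a = z")
      (simp_all add: circuit_vec_def circuit_arcs_3 arc_vec_def basis_vec_def)
qed

lemma circuit_vec_4:
  assumes "distinct [x, y, z, w]"
  shows "circuit_vec [x, y, z, w] =
    (\<lambda>s. arc_vec x y s + arc_vec y z s + arc_vec z w s + arc_vec w x s)"
proof
  fix s :: "'a \<times> 'a"
  obtain a b where "s = (a, b)" by (cases s)
  then show "circuit_vec [x, y, z, w] s = arc_vec x y s + arc_vec y z s + arc_vec z w s + arc_vec w x s"
    using assms
    by (cases "a = x"; cases "a = y"; cases "a = z"; cases "a = w")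
      (simp_all add: circuit_vec_def circuit_arcs_4 arc_vec_def basis_vec_def)
qed

lemma arc_vec_outside:
  assumes G: "pair_graph G" and "(x, y) \<in> parcs G" "s \<notin> parcs G"
  shows "arc_vec x y s = 0"
proof -
  have "s \<noteq> (x, y)" "s \<noteq> (y, x)" using assms(2,3) pair_graphD(5)[OF G assms(2)] by auto
  then show ?thesis by (simp add: arc_vec_def basis_vec_def)
qed

lemma arc_vec_swap: "(arc_vec x y (b, a) :: 'f::field) = - arc_vec x y (a, b)" for x y a b :: 'a
proof -
  have "basis_vec (u, v) (b, a) = (basis_vec (v, u) (a, b) :: 'f)" for u v :: 'a
    unfolding basis_vec_def by (rule if_cong) auto
  then show ?thesis by (simp only: arc_vec_def minus_diff_eq)
qed

text \<open>The net flow of one arc out of the vertex \<open>a\<close>. Along a closed circuit these contributions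
  telescope to zero.\<close>

lemma sum_arc_vec:
  assumes G: "pair_graph G" and xy: "(x, y) \<in> parcs G"
  shows "(\<Sum>b | (a, b) \<in> parcs G. arc_vec x y (a, b)) =
    ((if a = x then 1 else 0) - (if a = y then 1 else 0) :: 'f::field)"
proof -
  have "(arc_vec x y (a, b) :: 'f) =
      (if b = y then if a = x then 1 else 0 else 0) - (if b = x then if a = y then 1 else 0 else 0)" for b
    by (simp add: arc_vec_def basis_vec_def)
  then show ?thesis
    using xy pair_graphD(5)[OF G xy] pair_graphD(4,6)[OF G]
    by (auto simp: sum_subtractf sum.delta)
qed

lemma circuit_vec_in_cycle_space:
  assumes G: "pair_graph G" and "circuit G xs" "length xs \<in> {3, 4}"
  shows "circuit_vec xs \<in> carrier (cycle_space G)"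
proof -
  consider x y z where "xs = [x, y, z]" | x y z w where "xs = [x, y, z, w]"
    using assms(3) by (auto simp: length_Suc_conv numeral_3_eq_3 numeral_eq_Suc)
  then show ?thesis
  proof cases
    case 1
    then have arcs: "(x, y) \<in> parcs G" "(y, z) \<in> parcs G" "(z, x) \<in> parcs G" "distinct [x, y, z]"
      using assms(2) by (auto simp: circuit_def circuit_arcs_3)
    show ?thesis
      unfolding 1 circuit_vec_3[OF arcs(4)]
    proof (rule cycle_spaceI)
      fix a b
      show "arc_vec x y (a, b) + arc_vec y z (a, b) + arc_vec z x (a, b) = - (arc_vec x y (b, a) + arc_vec y z (b, a) + arc_vec z x (b, a))"
        unfolding arc_vec_swap[of _ _ b a] by simp
    qed (simp_all add: arc_vec_outside[OF G] sum_arc_vec[OF G] sum.distrib arcs(1-3))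
  next
    case 2
    then have arcs: "(x, y) \<in> parcs G" "(y, z) \<in> parcs G" "(z, w) \<in> parcs G" "(w, x) \<in> parcs G"
        "distinct [x, y, z, w]"
      using assms(2) by (auto simp: circuit_def circuit_arcs_4)
    show ?thesis
      unfolding 2 circuit_vec_4[OF arcs(5)]
    proof (rule cycle_spaceI)
      fix a b
      show "arc_vec x y (a, b) + arc_vec y z (a, b) + arc_vec z w (a, b) + arc_vec w x (a, b) = - (arc_vec x y (b, a) + arc_vec y z (b, a) + arc_vec z w (b, a) + arc_vec w x (b, a))"
        unfolding arc_vec_swap[of _ _ b a] by simp
    qed (simp_all add: arc_vec_outside[OF G] sum_arc_vec[OF G] sum.distrib arcs(1-4))
  qed
qed

lemma subspace_TS:
  assumes "pair_graph G"
  shows "submodule (TS G :: ('a \<times> 'a \<Rightarrow> 'f::field) set) scalars (cycle_space G)"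
  unfolding TS_def
proof (rule subspace_lin_span[OF module_cycle_space], rule subsetI)
  fix \<phi> :: "'a \<times> 'a \<Rightarrow> 'f"
  assume "\<phi> \<in> {circuit_vec xs | xs. circuit G xs \<and> length xs \<in> {3, 4}}"
  then obtain xs where xs: "\<phi> = circuit_vec xs" "circuit G xs" "length xs \<in> {3, 4}" by blast
  show "\<phi> \<in> carrier (cycle_space G)"
    unfolding xs(1) by (rule circuit_vec_in_cycle_space[OF assms xs(2,3)])
qed

text \<open>In this form the pointwise sums of \<open>subspace_sum\<close> apply to \<open>TS G\<close>.\<close>

lemma subspace_TS_fun_space:
  assumes "pair_graph G"
  shows "submodule (TS G :: ('a \<times> 'a \<Rightarrow> 'f::field) set) scalars (fun_space (parcs G))"
proof (rule subspace_fun_spaceI)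
  note TS = subspaceD[OF subspace_TS[OF assms], unfolded cycle_space_simps]
  show "f s = 0" if "f \<in> TS G" "s \<notin> parcs G" for f :: "'a \<times> 'a \<Rightarrow> 'f" and s
    using TS(1) that cycle_spaceD(1)[OF _ that(2)] by blast
  show "(\<lambda>_. 0) \<in> (TS G :: ('a \<times> 'a \<Rightarrow> 'f) set)" by (rule TS(2))
  show "(\<lambda>s. f s + g s) \<in> TS G" if "f \<in> TS G" "g \<in> TS G" for f g :: "'a \<times> 'a \<Rightarrow> 'f"
    using that by (rule TS(3))
  show "(\<lambda>s. c * f s) \<in> TS G" if "f \<in> TS G" for f :: "'a \<times> 'a \<Rightarrow> 'f" and c
    using that by (rule TS(4))
qed

lemma circuit_vec_in_TS:
  assumes "circuit G xs" "length xs \<in> {3, 4}"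
  shows "circuit_vec xs \<in> TS G"
  unfolding TS_def by (rule subsetD[OF lin_span_superset]) (use assms in blast)

text \<open>The lemmas for triangles and squares say that two ways of walking from
  \<open>x\<close> to \<open>z\<close> in at most two steps differ by an element of \<open>TS G\<close>.\<close>

lemma triangle_in_TS:
  assumes G: "pair_graph G" and "(x, y) \<in> parcs G" "(y, z) \<in> parcs G" "(x, z) \<in> parcs G"
  shows "(\<lambda>s. arc_vec x y s + arc_vec y z s - arc_vec x z s) \<in> TS G"
proof -
  have "circuit G [x, y, z]" and dist: "distinct [x, y, z]"
    using assms(2-) pair_graphD(4,7)[OF G] by (auto simp: circuit_def circuit_arcs_3)
  then have "circuit_vec [x, y, z] \<in> TS G" by (intro circuit_vec_in_TS) auto
  then show ?thesis unfolding circuit_vec_3[OF dist] by (simp add: arc_vec_def algebra_simps)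
qed

lemma square_in_TS:
  assumes G: "pair_graph G" and "(x, y) \<in> parcs G" "(y, z) \<in> parcs G" "(x, w) \<in> parcs G" "(w, z) \<in> parcs G"
    and "x \<noteq> z" "y \<noteq> w"
  shows "(\<lambda>s. arc_vec x y s + arc_vec y z s - (arc_vec x w s + arc_vec w z s)) \<in> TS G"
proof -
  have "circuit G [x, y, z, w]" and dist: "distinct [x, y, z, w]"
    using assms(2-) pair_graphD(4,7)[OF G] by (auto simp: circuit_def circuit_arcs_4)
  then have "circuit_vec [x, y, z, w] \<in> TS G" by (intro circuit_vec_in_TS) auto
  then show ?thesis unfolding circuit_vec_4[OF dist] by (simp add: arc_vec_def algebra_simps)
qed

section \<open>Antisymmetrization and path cycles\<close>

text \<open>The linear map that carries the isomorphism. It depends only on the values of \<open>g\<close> on arcs,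
  hence, arcs having distinct ends, only on the coset of \<open>g\<close> modulo irregular chains.\<close>

definition antisym_map :: "'a pair_pre_digraph \<Rightarrow> ('a list \<Rightarrow> 'f::field) \<Rightarrow> 'a \<times> 'a \<Rightarrow> 'f" where
  "antisym_map G g = (\<lambda>(x, y). if (x, y) \<in> parcs G then g [x, y] - g [y, x] else 0)"

lemma linear_map_antisym_map:
  "linear_map (\<Lambda> G 1) (fun_space (parcs G)) (antisym_map G :: ('a list \<Rightarrow> 'f::field) \<Rightarrow> _)"
proof -
  have "antisym_map G f s = 0" if "s \<notin> parcs G" for f :: "'a list \<Rightarrow> 'f" and s
    using that by (cases s) (simp add: antisym_map_def)
  moreover have "antisym_map G (\<lambda>s. f s + g s) = (\<lambda>s. antisym_map G f s + antisym_map G g s)"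
    "antisym_map G (\<lambda>s. c * f s) = (\<lambda>s. c * antisym_map G f s)"
    for f g :: "'a list \<Rightarrow> 'f" and c
    by (simp_all add: antisym_map_def fun_eq_iff algebra_simps)
  ultimately show ?thesis by (simp add: linear_map_def path_space_def)
qed

lemma antisym_map_irregular:
  assumes G: "pair_graph G" and f: "f \<in> irregular_space G 1"
  shows "antisym_map G f = (\<lambda>_. 0)"
proof -
  have "f [x, y] = 0" if "x \<noteq> y" for x y
    using f that by (simp add: irregular_space_eq[OF pair_graphD(1)[OF G]] irregular_paths_1)
  then have "f [x, y] = 0" "f [y, x] = 0" if "(x, y) \<in> parcs G" for x y
    using pair_graphD(8)[OF G that] by auto
  then show ?thesis by (auto simp: antisym_map_def fun_eq_iff)
qed

lemma allowed_paths_1_iff: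
  assumes G: "pair_graph G"
  shows "[x, y] \<in> allowed_paths G 1 \<longleftrightarrow> (x, y) \<in> parcs G"
  unfolding allowed_paths_1 using pair_graphD(2,3)[OF G, of x y] by blast

lemma allowed_paths_2_iff:
  assumes G: "pair_graph G"
  shows "[x, y, z] \<in> allowed_paths G 2 \<longleftrightarrow> (x, y) \<in> parcs G \<and> (y, z) \<in> parcs G"
  unfolding allowed_paths_2
  using pair_graphD(2,3)[OF G, of x y] pair_graphD(2,3)[OF G, of y z] by blast

lemma allowed_chain_1_zero:
  assumes "pair_graph G" "g \<in> carrier (fun_space (allowed_paths G 1))" "(x, y) \<notin> parcs G"
  shows "g [x, y] = 0"
  using assms by (simp add: allowed_paths_1_iff)

lemma allowed_chains_subset: "carrier (fun_space (allowed_paths G m)) \<subseteq> carrier (\<Lambda> G m)"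
  unfolding path_space_def
  by (rule subspaceD(1)[OF subspace_carrier_fun_space[OF allowed_paths_subset]])

text \<open>For a chain on arcs the net outflow of its antisymmetrization at a vertex is minus the value
  of its boundary there. All paths of length zero are allowed and none is irregular, so vanishing of
  the boundary is the only condition that a path cycle has to satisfy.\<close>

lemma path_cycles_1_eq:
  assumes G: "pair_graph G"
  shows "path_cycles G 1 = path_coset G 1 `
    {g \<in> carrier (fun_space (allowed_paths G 1)). antisym_map G g \<in> carrier (cycle_space G :: ('f::field, _) module)}"
proof -
  note fin = pair_graphD(1)[OF G]
  have sub: "g \<in> carrier (\<Lambda> G 1)" if "g \<in> carrier (fun_space (allowed_paths G 1))" for g :: "'a list \<Rightarrow> 'f"
    using that allowed_chains_subset by blast
  have flow: "(\<Sum>y | (x, y) \<in> parcs G. antisym_map G g (x, y)) = - boundary 1 g [x]"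
    if g: "g \<in> carrier (fun_space (allowed_paths G 1))" and x: "x \<in> pverts G" for g :: "'a list \<Rightarrow> 'f" and x
  proof -
    have "g [x, y] - g [y, x] = 0" if "(x, y) \<notin> parcs G" for y
      using that allowed_chain_1_zero[OF G g] pair_graphD(7)[OF G, of x y] by simp
    then have "(\<Sum>y | (x, y) \<in> parcs G. antisym_map G g (x, y)) = (\<Sum>y\<in>pverts G. g [x, y] - g [y, x])"
      using pair_graphD(3)[OF G] fin
      by (intro sum.mono_neutral_cong_left) (auto simp: antisym_map_def)
    then show ?thesis
      by (simp add: boundary_1_apply[OF fin sub[OF g] x] flip: sum_negf)
  qed
  have cyc: "antisym_map G g \<in> carrier (cycle_space G) \<longleftrightarrow> boundary 1 g \<in> irregular_space G 0"
    if g: "g \<in> carrier (fun_space (allowed_paths G 1))" for g :: "'a list \<Rightarrow> 'f"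
  proof -
    have "antisym_map G g \<in> carrier (cycle_space G) \<longleftrightarrow> (\<forall>x \<in> pverts G. boundary 1 g [x] = 0)"
    proof -
      have "antisym_map G g s = 0" if "s \<notin> parcs G" for s
        using that by (cases s) (auto simp: antisym_map_def)
      moreover have "antisym_map G g (x, y) = - antisym_map G g (y, x)" if "(x, y) \<in> parcs G" for x y
        using that pair_graphD(5)[OF G that] by (simp add: antisym_map_def)
      ultimately have "antisym_map G g \<in> carrier (cycle_space G) \<longleftrightarrow>
          (\<forall>x \<in> pverts G. (\<Sum>y | (x, y) \<in> parcs G. antisym_map G g (x, y)) = 0)"
        unfolding carrier_cycle_space by blast
      then show ?thesis by (simp add: flow[OF g])
    qed
    also have "\<dots> \<longleftrightarrow> boundary 1 g \<in> irregular_space G 0"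
    proof -
      have out: "boundary 1 g s = 0" if "s \<notin> (\<lambda>x. [x]) ` pverts G" for s
        using that linear_mapD(1)[OF linear_map_boundary_1[OF fin] sub[OF g]]
        by (simp add: path_space_def)
      have "boundary 1 g s = 0" if "\<forall>x \<in> pverts G. boundary 1 g [x] = 0" for s
        using that out[of s] by (cases "s \<in> (\<lambda>x. [x]) ` pverts G") auto
      then have "(\<forall>x \<in> pverts G. boundary 1 g [x] = 0) \<longleftrightarrow> (\<forall>s. boundary 1 g s = 0)"
        by (intro iffI allI ballI) simp_all
      then show ?thesis by (simp add: irregular_space_eq[OF fin] irregular_paths_0)
    qed
    finally show ?thesis .
  qed
  have zero: "\<zero>\<^bsub>regular_space G 0\<^esub> = (irregular_space G 0 :: ('a list \<Rightarrow> 'f) set)"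
    by (simp add: regular_space_def quotient_space_def)
  have "path_coset G 1 g \<in> path_cycles G 1 \<longleftrightarrow> antisym_map G g \<in> carrier (cycle_space G)"
    if g: "g \<in> carrier (fun_space (allowed_paths G 1))" for g :: "'a list \<Rightarrow> 'f"
  proof -
    have bd: "boundary 1 g \<in> carrier (\<Lambda> G 0)"
      using linear_mapD(1)[OF linear_map_boundary_1[OF fin] sub[OF g]] .
    then have "path_coset G 0 (boundary 1 g) \<in> allowed_space G 0"
      unfolding allowed_space_eq[OF fin] allowed_paths_0 path_space_def by blast
    moreover have "path_coset G 1 g \<in> allowed_space G 1"
      unfolding allowed_space_eq[OF fin] using g by blast
    ultimately have "path_coset G 1 g \<in> path_cycles G 1 \<longleftrightarrow>
        path_coset G 0 (boundary 1 g) = irregular_space G 0"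
      by (simp add: path_cycles_def Omega_def zero reg_boundary_1[OF fin sub[OF g]])
    then show ?thesis
      using coset_eq_zero_iff[OF module_path_space subspace_irregular_space[OF fin] bd] cyc[OF g]
      by simp
  qed
  moreover have "path_cycles G 1 \<subseteq> path_coset G 1 ` carrier (fun_space (allowed_paths G 1) :: ('f, _) module)"
    unfolding allowed_space_eq[OF fin, symmetric] by (auto simp: path_cycles_def Omega_def)
  ultimately show ?thesis by blast
qed

section \<open>Boundaries of degree one and the span of triangles and squares\<close>

text \<open>The representatives of the elements of \<open>Omega G 2\<close>: chains on walks of two steps in whose
  boundary the non-arcs \<open>[x, z]\<close> with \<open>x \<noteq> z\<close> cancel.\<close>

definition fillings :: "'a pair_pre_digraph \<Rightarrow> ('a list \<Rightarrow> 'f::field) set" where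
  "fillings G = {f \<in> carrier (fun_space (allowed_paths G 2)).
     \<forall>x \<in> pverts G. \<forall>z \<in> pverts G. x \<noteq> z \<longrightarrow> (x, z) \<notin> parcs G \<longrightarrow> boundary 2 f [x, z] = 0}"

lemma fillings_subset: "(fillings G :: ('a list \<Rightarrow> 'f::field) set) \<subseteq> carrier (\<Lambda> G 2)"
proof
  fix f :: "'a list \<Rightarrow> 'f"
  assume "f \<in> fillings G"
  then have "f \<in> carrier (fun_space (allowed_paths G 2))"
    unfolding fillings_def mem_Collect_eq by (rule conjunct1)
  then show "f \<in> carrier (\<Lambda> G 2)" by (rule subsetD[OF allowed_chains_subset])
qed

lemma boundary_2_add:
  assumes "finite (pverts G)" "f \<in> carrier (\<Lambda> G 2)" "g \<in> carrier (\<Lambda> G 2)"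
  shows "boundary 2 (\<lambda>xs. f xs + g xs) = (\<lambda>xs. boundary 2 f xs + boundary 2 g xs)"
  using linear_mapD(2)[OF linear_map_boundary_2[OF assms(1)] assms(2,3)]
  unfolding path_space_def fun_space_simps .

lemma boundary_2_smult:
  assumes "finite (pverts G)" "f \<in> carrier (\<Lambda> G 2)"
  shows "boundary 2 (\<lambda>xs. c * f xs) = (\<lambda>xs. c * boundary 2 f xs)"
  using linear_mapD(3)[OF linear_map_boundary_2[OF assms(1)] assms(2)]
  unfolding path_space_def fun_space_simps .

lemma subspace_fillings:
  assumes fin: "finite (pverts G)"
  shows "submodule (fillings G :: ('a list \<Rightarrow> 'f::field) set) scalars (\<Lambda> G 2)"
proof -
  have "(\<lambda>_. 0) \<in> (fillings G :: ('a list \<Rightarrow> 'f) set)"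
    by (simp add: fillings_def boundary_def)
  moreover have "(\<lambda>xs. f xs + g xs) \<in> fillings G" if fg: "f \<in> fillings G" "g \<in> fillings G"
    for f g :: "'a list \<Rightarrow> 'f"
  proof -
    have "f \<in> carrier (\<Lambda> G 2)" "g \<in> carrier (\<Lambda> G 2)" using fg fillings_subset by blast+
    note add = boundary_2_add[OF fin this]
    show ?thesis unfolding fillings_def mem_Collect_eq add using fg by (simp add: fillings_def)
  qed
  moreover have "(\<lambda>xs. c * f xs) \<in> fillings G" if f: "f \<in> fillings G" for f :: "'a list \<Rightarrow> 'f" and c
  proof -
    have "f \<in> carrier (\<Lambda> G 2)" using f fillings_subset by blast
    note smult = boundary_2_smult[OF fin this]
    show ?thesis unfolding fillings_def mem_Collect_eq smult using f by (simp add: fillings_def)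
  qed
  ultimately show ?thesis
    using fillings_subset[of G] unfolding path_space_def
    by (intro subspace_fun_spaceI) (auto simp: subset_iff)
qed

lemma path_boundaries_1_eq:
  assumes G: "pair_graph G"
  shows "path_boundaries G 1 = (\<lambda>f. path_coset G 1 (boundary 2 f)) ` (fillings G :: ('a list \<Rightarrow> 'f::field) set)"
proof -
  note fin = pair_graphD(1)[OF G]
  have sub1: "g \<in> carrier (\<Lambda> G 1)" if "g \<in> carrier (fun_space (allowed_paths G 1))" for g :: "'a list \<Rightarrow> 'f"
    using that allowed_chains_subset by blast
  have sub2: "f \<in> carrier (\<Lambda> G 2)" if "f \<in> carrier (fun_space (allowed_paths G 2))" for f :: "'a list \<Rightarrow> 'f"
    using that allowed_chains_subset by blast
  have iff: "path_coset G 2 f \<in> Omega G 2 \<longleftrightarrow> f \<in> fillings G"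
    if f: "f \<in> carrier (fun_space (allowed_paths G 2))" for f :: "'a list \<Rightarrow> 'f"
  proof -
    have bd: "boundary 2 f \<in> carrier (\<Lambda> G 1)"
      using linear_mapD(1)[OF linear_map_boundary_2[OF fin] sub2[OF f]] .
    have "path_coset G 2 f \<in> allowed_space G 2"
      unfolding allowed_space_eq[OF fin] using f by blast
    then have "path_coset G 2 f \<in> Omega G 2 \<longleftrightarrow> path_coset G 1 (boundary 2 f) \<in> allowed_space G 1"
      by (simp add: Omega_def reg_boundary_2[OF fin sub2[OF f]])
    also have "\<dots> \<longleftrightarrow> (\<exists>g \<in> carrier (fun_space (allowed_paths G 1)).
        \<forall>xs. xs \<notin> irregular_paths G 1 \<longrightarrow> boundary 2 f xs = g xs)"
      unfolding allowed_space_eq[OF fin] image_iff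
      using path_coset_eq_iff[OF fin bd sub1] by blast
    also have "\<dots> \<longleftrightarrow> (\<forall>xs. xs \<notin> irregular_paths G 1 \<longrightarrow> xs \<notin> allowed_paths G 1 \<longrightarrow> boundary 2 f xs = 0)"
      by (auto intro!: bexI[of _ "\<lambda>xs. if xs \<in> allowed_paths G 1 then boundary 2 f xs else 0"])
    also have "\<dots> \<longleftrightarrow> (\<forall>xs \<in> elem_paths G 1. xs \<notin> irregular_paths G 1 \<longrightarrow> xs \<notin> allowed_paths G 1 \<longrightarrow>
        boundary 2 f xs = 0)"
      using bd by (auto simp: path_space_def)
    also have "\<dots> \<longleftrightarrow> f \<in> fillings G"
      using f by (simp add: elem_paths_1 fillings_def irregular_paths_1 allowed_paths_1_iff[OF G])
    finally show ?thesis .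
  qed
  have "Omega G 2 \<subseteq> path_coset G 2 ` carrier (fun_space (allowed_paths G 2) :: ('f, _) module)"
    unfolding allowed_space_eq[OF fin, symmetric] by (auto simp: Omega_def)
  then have "Omega G 2 = path_coset G 2 ` (fillings G :: ('a list \<Rightarrow> 'f) set)"
    using iff by (auto simp: fillings_def)
  then have "path_boundaries G 1 = (\<lambda>f. reg_boundary G 2 (path_coset G 2 f)) ` (fillings G :: ('a list \<Rightarrow> 'f) set)"
    by (simp add: path_boundaries_def image_image)
  also have "\<dots> = (\<lambda>f. path_coset G 1 (boundary 2 f)) ` fillings G"
    by (rule image_cong[OF refl reg_boundary_2[OF fin]]) (use fillings_subset in blast)
  finally show ?thesis .
qed

lemma antisym_map_boundary_2:
  assumes fin: "finite (pverts G)" and f: "f \<in> carrier (\<Lambda> G 2)" and s: "s \<in> parcs G"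
  shows "antisym_map G (boundary 2 f) s = (\<Sum>x\<in>pverts G. \<Sum>y\<in>pverts G. \<Sum>z\<in>pverts G.
    f [x, y, z] * (arc_vec x y s + arc_vec y z s - arc_vec x z s))"
proof -
  obtain a b where ab: "s = (a, b)" by (cases s)
  have *: "arc_vec x y s = basis_vec [x, y] [a, b] - basis_vec [x, y] [b, a]" for x y
    by (auto simp: ab arc_vec_def basis_vec_def)
  show ?thesis
    using s unfolding ab[symmetric] *
    by (simp add: antisym_map_def ab boundary_2_sum[OF fin f] algebra_simps
        flip: sum_subtractf)
qed

text \<open>Write \<open>a(x, y)\<close> for \<open>arc_vec x y\<close>. The boundary of the walk \<open>[x, y, z]\<close> antisymmetrizes to
  \<open>a(x, y) + a(y, z) - a(x, z)\<close>, where the last term has to be left out if \<open>(x, z)\<close> is not an arc.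
  The idea is to replace this last term by a reference \<open>w x z\<close> that depends on the ends only: the arc
  itself if there is one, zero if \<open>x = z\<close>, and otherwise the walk through a chosen common neighbour.
  The difference \<open>\<tau> (x, y, z)\<close> is then a triangle, a square or zero. Replacing the last term does not
  change the total: for a non-arc with \<open>x \<noteq> z\<close> the coefficients of the walks from \<open>x\<close> to \<open>z\<close> add up
  to zero, because \<open>[x, z]\<close> cancels in the boundary of a filling.\<close>

lemma antisym_map_boundary_in_TS:
  fixes f :: "'a list \<Rightarrow> 'f::field"
  assumes G: "pair_graph G" and f: "f \<in> fillings G"
  shows "antisym_map G (boundary 2 f) \<in> TS G"
proof -
  note fin = pair_graphD(1)[OF G]
  let ?V = "pverts G"
  have f0: "f [x, y, z] = 0" if "(x, y) \<notin> parcs G \<or> (y, z) \<notin> parcs G" for x y z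
    using f that by (auto simp: fillings_def allowed_paths_2_iff[OF G])
  have fL: "f \<in> carrier (\<Lambda> G 2)" using f fillings_subset by blast
  \<comment> \<open>The reference neighbour must not depend on \<open>y\<close>, hence the choice.\<close>
  define c where "c x z = (SOME y. (x, y) \<in> parcs G \<and> (y, z) \<in> parcs G)" for x z
  have c: "(x, c x z) \<in> parcs G" "(c x z, z) \<in> parcs G" if "(x, y) \<in> parcs G" "(y, z) \<in> parcs G" for x y z
    using someI[of "\<lambda>y. (x, y) \<in> parcs G \<and> (y, z) \<in> parcs G" y] that by (auto simp: c_def)
  define w :: "'a \<Rightarrow> 'a \<Rightarrow> 'a \<times> 'a \<Rightarrow> 'f" where
    "w x z = (\<lambda>s. if (x, z) \<in> parcs G then arc_vec x z s else if x = z then 0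
       else arc_vec x (c x z) s + arc_vec (c x z) z s)" for x z
  define \<tau> :: "'a \<times> 'a \<times> 'a \<Rightarrow> 'a \<times> 'a \<Rightarrow> 'f" where
    "\<tau> = (\<lambda>(x, y, z) s. arc_vec x y s + arc_vec y z s - w x z s)"
  have TS: "submodule (TS G :: ('a \<times> 'a \<Rightarrow> 'f) set) scalars (fun_space (parcs G))"
    by (rule subspace_TS_fun_space[OF G])
  have \<tau>: "\<tau> (x, y, z) \<in> TS G" if arcs: "(x, y) \<in> parcs G" "(y, z) \<in> parcs G" for x y z
  proof -
    consider "(x, z) \<in> parcs G" | "(x, z) \<notin> parcs G" "x = z \<or> y = c x z"
      | "(x, z) \<notin> parcs G" "x \<noteq> z" "y \<noteq> c x z" by blast
    then show ?thesis
    proof cases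
      case 1
      then show ?thesis using triangle_in_TS[OF G arcs 1] by (simp add: \<tau>_def w_def)
    next
      case 2
      then have "\<tau> (x, y, z) = (\<lambda>_. 0)"
        by (auto simp: \<tau>_def w_def arc_vec_def fun_eq_iff)
      then show ?thesis using subspaceD(2)[OF TS] by simp
    next
      case 3
      then show ?thesis
        using square_in_TS[OF G arcs c[OF arcs] 3(2,3)] by (simp add: \<tau>_def w_def)
    qed
  qed
  have w0: "(\<Sum>y\<in>?V. f [x, y, z]) * (w x z s - arc_vec x z s) = 0" if "x \<in> ?V" "z \<in> ?V" for x z s
  proof (cases "(x, z) \<in> parcs G \<or> x = z")
    case True
    then show ?thesis by (auto simp: w_def arc_vec_def)
  next
    case False
    then have "boundary 2 f [x, z] = 0" using f that by (simp add: fillings_def)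
    \<comment> \<open>Of the three kinds of walk with face \<open>[x, z]\<close>, two would use it as a step.\<close>
    moreover have "f [y, x, z] - f [x, y, z] + f [x, z, y] = - f [x, y, z]" for y
      using False by (simp add: f0)
    ultimately have "(\<Sum>y\<in>?V. f [x, y, z]) = 0"
      by (simp add: boundary_2_apply[OF fin fL that] sum_negf)
    then show ?thesis by simp
  qed
  have "antisym_map G (boundary 2 f) s = (\<Sum>t \<in> ?V \<times> ?V \<times> ?V. f [fst t, fst (snd t), snd (snd t)] * \<tau> t s)" for s
  proof (cases "s \<in> parcs G")
    case True
    have "(\<Sum>t \<in> ?V \<times> ?V \<times> ?V. f [fst t, fst (snd t), snd (snd t)] * \<tau> t s) =
        (\<Sum>x\<in>?V. \<Sum>y\<in>?V. \<Sum>z\<in>?V. f [x, y, z] * \<tau> (x, y, z) s)"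
      by (simp add: sum.cartesian_product case_prod_unfold)
    moreover have "(\<Sum>x\<in>?V. \<Sum>y\<in>?V. \<Sum>z\<in>?V. f [x, y, z] * (w x z s - arc_vec x z s)) = 0"
    proof (rule sum.neutral, rule ballI)
      fix x assume x: "x \<in> ?V"
      have "(\<Sum>y\<in>?V. \<Sum>z\<in>?V. f [x, y, z] * (w x z s - arc_vec x z s)) =
          (\<Sum>z\<in>?V. (\<Sum>y\<in>?V. f [x, y, z]) * (w x z s - arc_vec x z s))"
        by (subst sum.swap) (simp add: sum_distrib_right)
      also have "\<dots> = 0" using w0[OF x] by (intro sum.neutral) blast
      finally show "(\<Sum>y\<in>?V. \<Sum>z\<in>?V. f [x, y, z] * (w x z s - arc_vec x z s)) = 0" .
    qed
    moreover have "f [x, y, z] * (arc_vec x y s + arc_vec y z s - arc_vec x z s) =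
        f [x, y, z] * \<tau> (x, y, z) s + f [x, y, z] * (w x z s - arc_vec x z s)" for x y z
      by (simp add: \<tau>_def algebra_simps)
    ultimately show ?thesis
      by (simp add: antisym_map_boundary_2[OF fin fL True] sum.distrib)
  next
    case False
    have "f [x, y, z] * \<tau> (x, y, z) s = 0" for x y z
    proof (cases "(x, y) \<in> parcs G \<and> (y, z) \<in> parcs G")
      case True
      then have "\<tau> (x, y, z) \<in> carrier (fun_space (parcs G))"
        using subspaceD(1)[OF TS] \<tau> by blast
      then show ?thesis using \<open>s \<notin> parcs G\<close> by (cases s) simp
    next
      case False
      then have "f [x, y, z] = 0" using f0 by blast
      then show ?thesis by simp
    qed
    then have "f [fst t, fst (snd t), snd (snd t)] * \<tau> t s = 0" for t
      using prod.collapse by metis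
    moreover have "antisym_map G (boundary 2 f) s = 0"
      using False by (cases s) (simp add: antisym_map_def)
    ultimately show ?thesis by (simp only: sum.neutral_const)
  qed
  then have eq: "antisym_map G (boundary 2 f) =
      (\<lambda>s. \<Sum>t \<in> ?V \<times> ?V \<times> ?V. f [fst t, fst (snd t), snd (snd t)] * \<tau> t s)"
    by (rule ext)
  show ?thesis
    unfolding eq
  proof (rule subspace_sum[OF TS])
    show "finite (?V \<times> ?V \<times> ?V)" using fin by simp
    fix t :: "'a \<times> 'a \<times> 'a"
    assume t: "f [fst t, fst (snd t), snd (snd t)] \<noteq> 0"
    obtain x y z where "t = (x, y, z)" by (cases t)
    then show "\<tau> t \<in> TS G" using t \<tau>[of x y z] f0[of x y z] by fastforce
  qed
qed

lemma boundary_basis_vec_2: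
  "boundary 2 (basis_vec [x, y, z]) =
    (\<lambda>ys. basis_vec [y, z] ys - basis_vec [x, z] ys + basis_vec [x, y] ys)"
proof -
  have "{xs. basis_vec [x, y, z] xs \<noteq> (0 :: 'b)} = {[x, y, z]}" by (auto simp: basis_vec_def)
  moreover have "basis_vec [x, y, z] [x, y, z] = (1 :: 'b)" by (simp add: basis_vec_def)
  ultimately show ?thesis by (simp add: boundary_def fun_eq_iff)
qed

lemma antisym_map_basis_vec:
  assumes G: "pair_graph G" and "(x, y) \<in> parcs G"
  shows "antisym_map G (basis_vec [x, y]) = arc_vec x y"
proof
  fix s :: "'a \<times> 'a"
  obtain a b where s: "s = (a, b)" by (cases s)
  show "antisym_map G (basis_vec [x, y]) s = arc_vec x y s"
  proof (cases "s \<in> parcs G")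
    case True
    then show ?thesis by (simp add: s antisym_map_def arc_vec_def basis_vec_def)
  next
    case False
    then show ?thesis using arc_vec_outside[OF assms False] by (simp add: s antisym_map_def)
  qed
qed

lemma basis_vec_carrier: "s \<in> S \<Longrightarrow> basis_vec s \<in> carrier (fun_space S)"
  by (auto simp: basis_vec_def)

text \<open>A triangle is filled by the single walk \<open>[x, y, z]\<close>, a square by the difference
  of the two walks between opposite corners; the diagonal \<open>[x, z]\<close> cancels in this difference, whether
  it is an arc or not.\<close>

lemma TS_filled:
  assumes G: "pair_graph G"
  shows "TS G \<subseteq> (\<lambda>f. antisym_map G (boundary 2 f)) ` (fillings G :: ('a list \<Rightarrow> 'f::field) set)"
proof -
  note fin = pair_graphD(1)[OF G] and sym = pair_graphD(5)[OF G]
  let ?h = "\<lambda>f :: 'a list \<Rightarrow> 'f. antisym_map G (boundary 2 f)"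
  have h: "linear_map (\<Lambda> G 2) (fun_space (parcs G)) ?h"
    by (rule linear_map_comp[OF linear_map_boundary_2[OF fin] linear_map_antisym_map])
  have H: "submodule (?h ` fillings G) scalars (fun_space (parcs G))"
    by (rule subspace_image[OF module_path_space module_fun_space h subspace_fillings[OF fin]])
  have "?h ` fillings G \<subseteq> carrier (cycle_space G)"
    using antisym_map_boundary_in_TS[OF G] subspaceD(1)[OF subspace_TS[OF G]] by blast
  then have H': "submodule (?h ` fillings G) scalars (cycle_space G)"
    using subspaceD[OF H] by (intro subspaceI[OF module_cycle_space]) auto
  have am: "antisym_map G (\<lambda>s. p s - q s + r s) =
      (\<lambda>s. antisym_map G p s - antisym_map G q s + antisym_map G r s)" for p q r :: "'a list \<Rightarrow> 'f"
    by (auto simp: antisym_map_def)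
  have am': "antisym_map G (\<lambda>s. p s - q s) = (\<lambda>s. antisym_map G p s - antisym_map G q s)"
    for p q :: "'a list \<Rightarrow> 'f" by (auto simp: antisym_map_def)
  have bd': "boundary 2 (\<lambda>s. p s - q s) = (\<lambda>s. boundary 2 p s - boundary 2 q s)"
    if "p \<in> carrier (\<Lambda> G 2)" "q \<in> carrier (\<Lambda> G 2)" for p q :: "'a list \<Rightarrow> 'f"
  proof -
    have "(\<lambda>s. - 1 * q s) \<in> carrier (\<Lambda> G 2)" using that by (simp add: path_space_def)
    then show ?thesis
      using boundary_2_add[OF fin that(1), of "\<lambda>s. - 1 * q s"] boundary_2_smult[OF fin that(2), of "- 1"] by simp
  qed
  have "circuit_vec xs \<in> ?h ` fillings G" if xs: "circuit G xs" "length xs \<in> {3, 4}" for xs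
  proof -
    consider x y z where "xs = [x, y, z]" | x y z w where "xs = [x, y, z, w]"
      using xs(2) by (auto simp: length_Suc_conv numeral_3_eq_3 numeral_eq_Suc)
    then show ?thesis
    proof cases
      case 1
      then have arcs: "(x, y) \<in> parcs G" "(y, z) \<in> parcs G" "(z, x) \<in> parcs G" "distinct [x, y, z]"
        using xs(1) by (auto simp: circuit_def circuit_arcs_3)
      have xz: "(x, z) \<in> parcs G" using arcs sym by blast
      let ?f = "basis_vec [x, y, z] :: 'a list \<Rightarrow> 'f"
      have "?f \<in> carrier (fun_space (allowed_paths G 2))"
        by (rule basis_vec_carrier) (simp add: allowed_paths_2_iff[OF G] arcs)
      then have "?f \<in> fillings G"
        unfolding fillings_def mem_Collect_eq boundary_basis_vec_2 using arcs xz
        by (auto simp: basis_vec_def)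
      moreover have "?h ?f = circuit_vec [x, y, z]"
        unfolding boundary_basis_vec_2 circuit_vec_3[OF arcs(4)] am
          antisym_map_basis_vec[OF G arcs(1)] antisym_map_basis_vec[OF G arcs(2)]
          antisym_map_basis_vec[OF G xz]
        by (simp add: arc_vec_def fun_eq_iff)
      ultimately show ?thesis unfolding 1 by (intro image_eqI[where x = ?f]) simp_all
    next
      case 2
      then have arcs: "(x, y) \<in> parcs G" "(y, z) \<in> parcs G" "(z, w) \<in> parcs G" "(w, x) \<in> parcs G"
          "distinct [x, y, z, w]"
        using xs(1) by (auto simp: circuit_def circuit_arcs_4)
      have arcs': "(w, z) \<in> parcs G" "(x, w) \<in> parcs G" using arcs sym by blast+
      let ?p = "basis_vec [x, y, z] :: 'a list \<Rightarrow> 'f" and ?q = "basis_vec [x, w, z] :: 'a list \<Rightarrow> 'f"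
      have pq: "?p \<in> carrier (fun_space (allowed_paths G 2))" "?q \<in> carrier (fun_space (allowed_paths G 2))"
        by (rule basis_vec_carrier; simp add: allowed_paths_2_iff[OF G] arcs arcs')+
      then have pq': "?p \<in> carrier (\<Lambda> G 2)" "?q \<in> carrier (\<Lambda> G 2)"
        using allowed_chains_subset by blast+
      have bd: "boundary 2 (\<lambda>s. ?p s - ?q s) =
          (\<lambda>s. basis_vec [x, y] s - basis_vec [x, w] s + (basis_vec [y, z] s - basis_vec [w, z] s))"
        unfolding bd'[OF pq'] boundary_basis_vec_2 by (simp add: fun_eq_iff)
      have "(\<lambda>s. ?p s - ?q s) \<in> fillings G"
        unfolding fillings_def mem_Collect_eq bd using pq arcs arcs'
        by (auto simp: basis_vec_def)
      moreover have "?h (\<lambda>s. ?p s - ?q s) = circuit_vec [x, y, z, w]"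
        unfolding bd am am' circuit_vec_4[OF arcs(5)]
          antisym_map_basis_vec[OF G arcs(1)] antisym_map_basis_vec[OF G arcs(2)]
          antisym_map_basis_vec[OF G arcs'(1)] antisym_map_basis_vec[OF G arcs'(2)]
        by (simp add: arc_vec_def fun_eq_iff)
      ultimately show ?thesis unfolding 2 by (intro image_eqI[where x = "\<lambda>s. ?p s - ?q s"]) simp_all
    qed
  qed
  then show ?thesis
    unfolding TS_def by (intro lin_span_minimal[OF _ H']) blast
qed

lemma two_neq_zero:
  assumes "CHAR('f::field) \<noteq> 2"
  shows "(2 :: 'f) \<noteq> 0"
proof
  assume "(2 :: 'f) = 0"
  then have "CHAR('f) dvd 2"
    using of_nat_eq_0_iff_char_dvd[of 2, where 'a = 'f] by simp
  then have "CHAR('f) = 1 \<or> CHAR('f) = 2"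
    using prime_nat_iff two_is_prime_nat by blast
  then show False using assms by simp
qed

text \<open>The boundary of the walk \<open>[x, y, x]\<close> is \<open>[y, x] + [x, y]\<close>, because \<open>[x, x]\<close> is irregular.
  A symmetric chain is therefore the boundary of the sum, over both directions of every edge, of the
  corresponding back-and-forth walks, weighted by half its value on that edge.\<close>

lemma symmetric_chain_filled:
  fixes u :: "'a list \<Rightarrow> 'f::field"
  assumes G: "pair_graph G" and char: "CHAR('f) \<noteq> 2"
    and u: "u \<in> carrier (fun_space (allowed_paths G 1))" and sym: "\<And>x y. u [x, y] = u [y, x]"
  obtains f where "f \<in> fillings G" "path_coset G 1 (boundary 2 f) = path_coset G 1 u"
proof -
  note fin = pair_graphD(1)[OF G]
  \<comment> \<open>The support is cut down to \<open>elem_paths G 2\<close> since list entries beyond the end are arbitrary.\<close>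
  define f where "f xs = (if xs \<in> elem_paths G 2 \<and> xs ! 0 = xs ! 2 then u [xs ! 0, xs ! 1] / 2 else 0)" for xs
  have f_simp: "f [x, y, z] = (if x = z then u [x, y] / 2 else 0)" for x y z
    using allowed_chain_1_zero[OF G u, of x y] pair_graphD(2,3)[OF G, of x y]
    by (auto simp: f_def elem_paths_def)
  have fA: "f \<in> carrier (fun_space (allowed_paths G 2))"
  proof -
    have "f xs = 0" if "xs \<notin> allowed_paths G 2" for xs
    proof (cases "xs \<in> elem_paths G 2")
      case True
      then obtain x y z where xs: "xs = [x, y, z]" by (auto simp: elem_paths_2)
      then show ?thesis
        using that u pair_graphD(7)[OF G]
        by (auto simp: f_simp allowed_paths_2_iff[OF G] allowed_paths_1_iff[OF G])
    qed (simp add: f_def)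
    then show ?thesis by simp
  qed
  then have fL: "f \<in> carrier (\<Lambda> G 2)"
    using allowed_chains_subset by blast
  have bd: "boundary 2 f [a, b] = u [a, b]" if ab: "a \<in> pverts G" "b \<in> pverts G" "a \<noteq> b" for a b
  proof -
    have "boundary 2 f [a, b] = (\<Sum>c\<in>pverts G. (if c = b then u [b, a] / 2 else 0) + (if c = a then u [a, b] / 2 else 0))"
      unfolding boundary_2_apply[OF fin fL ab(1,2)] using ab(3)
      by (intro sum.cong) (auto simp: f_simp)
    also have "\<dots> = u [b, a] / 2 + u [a, b] / 2"
      using fin ab by (simp add: sum.distrib sum.delta)
    also have "\<dots> = u [a, b]"
      using two_neq_zero[OF char] by (simp add: sym[of b a] flip: mult_2)
    finally show ?thesis .
  qed
  have "f \<in> fillings G"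
    using fA bd u by (auto simp: fillings_def allowed_paths_1_iff[OF G])
  moreover have "path_coset G 1 (boundary 2 f) = path_coset G 1 u"
  proof -
    have bL: "boundary 2 f \<in> carrier (\<Lambda> G 1)"
      using linear_mapD(1)[OF linear_map_boundary_2[OF fin] fL] .
    have uL: "u \<in> carrier (\<Lambda> G 1)" using u allowed_chains_subset by blast
    have "boundary 2 f xs = u xs" if "xs \<notin> irregular_paths G 1" for xs
    proof (cases "xs \<in> elem_paths G 1")
      case True
      then obtain a b where ab: "xs = [a, b]" "a \<in> pverts G" "b \<in> pverts G" by (auto simp: elem_paths_1)
      then show ?thesis using that bd[of a b] by (auto simp: irregular_paths_1)
    next
      case False
      then show ?thesis using bL uL by (simp add: path_space_def)
    qed
    then show ?thesis using path_coset_eq_iff[OF fin bL uL] by blast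
  qed
  ultimately show thesis by (rule that)
qed

text \<open>From left to right this is \<open>antisym_map_boundary_in_TS\<close>. Conversely, choose a filling \<open>f\<close>
  whose boundary has the same antisymmetrization as \<open>g\<close>. The difference of \<open>g\<close> and that boundary is
  symmetric, hence a boundary as well.\<close>

lemma path_coset_boundaries_iff:
  fixes g :: "'a list \<Rightarrow> 'f::field"
  assumes G: "pair_graph G" and char: "CHAR('f) \<noteq> 2"
    and g: "g \<in> carrier (fun_space (allowed_paths G 1))"
  shows "path_coset G 1 g \<in> path_boundaries G 1 \<longleftrightarrow> antisym_map G g \<in> TS G"
proof -
  note fin = pair_graphD(1)[OF G]
  have gL: "g \<in> carrier (\<Lambda> G 1)" using g allowed_chains_subset by blast
  have eq: "antisym_map G p = antisym_map G q"
    if pq: "p \<in> carrier (\<Lambda> G 1)" "q \<in> carrier (\<Lambda> G 1)" and "path_coset G 1 p = path_coset G 1 q"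
    for p q :: "'a list \<Rightarrow> 'f"
  proof -
    have "p [x, y] = q [x, y]" "p [y, x] = q [y, x]" if "(x, y) \<in> parcs G" for x y
      using \<open>path_coset G 1 p = path_coset G 1 q\<close> path_coset_eq_iff[OF fin pq]
        pair_graphD(8)[OF G that] by (auto simp: irregular_paths_1)
    then show ?thesis by (auto simp: antisym_map_def fun_eq_iff)
  qed
  have bL: "boundary 2 f \<in> carrier (\<Lambda> G 1)" if "f \<in> fillings G" for f :: "'a list \<Rightarrow> 'f"
    using linear_mapD(1)[OF linear_map_boundary_2[OF fin]] fillings_subset that by blast
  show ?thesis
  proof
    assume "path_coset G 1 g \<in> path_boundaries G 1"
    then obtain f where f: "f \<in> fillings G" "path_coset G 1 g = path_coset G 1 (boundary 2 f)"
      unfolding path_boundaries_1_eq[OF G] by blast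
    then show "antisym_map G g \<in> TS G"
      using antisym_map_boundary_in_TS[OF G f(1)] eq[OF gL bL[OF f(1)] f(2)] by simp
  next
    assume "antisym_map G g \<in> TS G"
    then obtain f where f: "f \<in> fillings G" "antisym_map G g = antisym_map G (boundary 2 f)"
      using TS_filled[OF G] by blast
    \<comment> \<open>Restricting to arcs discards only irregular terms of the boundary of a filling.\<close>
    define u where "u xs = (if xs \<in> allowed_paths G 1 then g xs - boundary 2 f xs else 0)" for xs
    have "g [x, y] - g [y, x] = boundary 2 f [x, y] - boundary 2 f [y, x]" if "(x, y) \<in> parcs G" for x y
      using fun_cong[OF f(2), of "(x, y)"] that by (simp add: antisym_map_def)
    note diff = this
    have sym: "u [x, y] = u [y, x]" for x y
    proof (cases "(x, y) \<in> parcs G")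
      case True
      have "u [x, y] = (g [x, y] - g [y, x]) - (boundary 2 f [x, y] - boundary 2 f [y, x])
          + (g [y, x] - boundary 2 f [y, x])"
        using True by (simp add: u_def allowed_paths_1_iff[OF G])
      then show ?thesis
        unfolding diff[OF True]
        using pair_graphD(5)[OF G True] by (simp add: u_def allowed_paths_1_iff[OF G])
    next
      case False
      then have "(y, x) \<notin> parcs G" using pair_graphD(5)[OF G, of y x] by blast
      then show ?thesis using False by (simp add: u_def allowed_paths_1_iff[OF G])
    qed
    have "u \<in> carrier (fun_space (allowed_paths G 1))" by (simp add: u_def)
    then obtain f' where f': "f' \<in> fillings G" "path_coset G 1 (boundary 2 f') = path_coset G 1 u"
      using symmetric_chain_filled[OF G char, of u] sym by blast
    have uL: "u \<in> carrier (\<Lambda> G 1)"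
      using \<open>u \<in> carrier (fun_space (allowed_paths G 1))\<close> allowed_chains_subset by blast
    have ff: "(\<lambda>s. f s + f' s) \<in> fillings G"
      using subspaceD(3)[OF subspace_fillings[OF fin] f(1) f'(1)] by (simp add: path_space_def)
    have bd: "boundary 2 (\<lambda>s. f s + f' s) = (\<lambda>s. boundary 2 f s + boundary 2 f' s)"
      using f(1) f'(1) fillings_subset[of G] by (intro boundary_2_add[OF fin]) blast+
    have "boundary 2 (\<lambda>s. f s + f' s) xs = g xs" if xs: "xs \<notin> irregular_paths G 1" for xs
    proof -
      have u': "boundary 2 f' xs = u xs"
        using f'(2) path_coset_eq_iff[OF fin bL[OF f'(1)] uL] xs by blast
      show ?thesis
      proof (cases "xs \<in> allowed_paths G 1")
        case True
        then show ?thesis by (simp add: bd u' u_def)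
      next
        case False
        have "boundary 2 f xs = 0"
        proof (cases "xs \<in> elem_paths G 1")
          case True
          then obtain a b where ab: "xs = [a, b]" "a \<in> pverts G" "b \<in> pverts G"
            by (auto simp: elem_paths_1)
          then show ?thesis
            using f(1) xs False by (auto simp: fillings_def irregular_paths_1 allowed_paths_1_iff[OF G])
        next
          case False
          then show ?thesis using bL[OF f(1)] by (simp add: path_space_def)
        qed
        then show ?thesis using False g by (simp add: bd u' u_def)
      qed
    qed
    then have "path_coset G 1 g = path_coset G 1 (boundary 2 (\<lambda>s. f s + f' s))"
      using path_coset_eq_iff[OF fin bL[OF ff] gL] by blast
    then show "path_coset G 1 g \<in> path_boundaries G 1"
      unfolding path_boundaries_1_eq[OF G] using ff
      by (intro image_eqI[where x = "\<lambda>s. f s + f' s"])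
  qed
qed

text \<open>Half of an antisymmetric function is a preimage.\<close>

lemma antisym_map_surj:
  fixes \<phi> :: "'a \<times> 'a \<Rightarrow> 'f::field"
  assumes G: "pair_graph G" and char: "CHAR('f) \<noteq> 2" and \<phi>: "\<phi> \<in> carrier (cycle_space G)"
  obtains g where "g \<in> carrier (fun_space (allowed_paths G 1))" "antisym_map G g = \<phi>"
proof
  let ?g = "\<lambda>xs. if xs \<in> allowed_paths G 1 then \<phi> (xs ! 0, xs ! 1) / 2 else 0"
  show "?g \<in> carrier (fun_space (allowed_paths G 1))" by simp
  show "antisym_map G ?g = \<phi>"
  proof
    fix s :: "'a \<times> 'a"
    obtain x y where s: "s = (x, y)" by (cases s)
    show "antisym_map G ?g s = \<phi> s"
    proof (cases "(x, y) \<in> parcs G")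
      case True
      note yx = pair_graphD(5)[OF G True]
      have "antisym_map G ?g s = \<phi> (x, y) / 2 - \<phi> (y, x) / 2"
        using True yx by (simp add: s antisym_map_def allowed_paths_1_iff[OF G])
      also have "\<dots> = \<phi> (x, y)"
        unfolding cycle_spaceD(2)[OF \<phi> yx] using two_neq_zero[OF char] by (simp flip: mult_2)
      finally show ?thesis by (simp add: s)
    next
      case False
      then show ?thesis using cycle_spaceD(1)[OF \<phi> False] by (simp add: s antisym_map_def)
    qed
  qed
qed

section \<open>The isomorphism\<close>

theorem theorem6p1:
  fixes G :: "'a pair_pre_digraph"
  assumes "pair_graph G"
    and "CHAR('f::field) \<noteq> 2"
  shows "(path_homology G 1 :: ('f, ('a list \<Rightarrow> 'f) set set) module)
           \<cong>\<^sub>v quotient_space (cycle_space G) (TS G)"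
proof -
  note G = assms(1) and char = assms(2) and fin = pair_graphD(1)[OF assms(1)]
  let ?R = "regular_space G 1 :: ('f, ('a list \<Rightarrow> 'f) set) module"
  let ?\<alpha> = "antisym_map G :: ('a list \<Rightarrow> 'f) \<Rightarrow> 'a \<times> 'a \<Rightarrow> 'f"
  let ?Z = "?R\<lparr>carrier := path_cycles G 1\<rparr>"
  let ?A = "{g \<in> carrier (fun_space (allowed_paths G 1)). ?\<alpha> g \<in> carrier (cycle_space G)}"
  have AL: "?A \<subseteq> carrier (\<Lambda> G 1)"
    using allowed_chains_subset by blast
  have ind: "induced_map ?\<alpha> (path_coset G 1 g) = ?\<alpha> g" if "g \<in> carrier (\<Lambda> G 1)" for g
    by (rule induced_map_coset[OF module_path_space subspace_irregular_space[OF fin]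
          module_fun_space linear_map_antisym_map _ that]) (simp add: antisym_map_irregular[OF G])
  have lin: "linear_map ?R (fun_space (parcs G)) (induced_map ?\<alpha>)"
    unfolding regular_space_def
    by (rule linear_map_induced_map[OF module_path_space subspace_irregular_space[OF fin]
          module_fun_space linear_map_antisym_map]) (simp add: antisym_map_irregular[OF G])
  have sub: "submodule (path_cycles G 1) scalars ?R"
  proof -
    have "submodule {g \<in> carrier (\<Lambda> G 1). ?\<alpha> g \<in> carrier (cycle_space G)} scalars (\<Lambda> G 1)"
      by (rule subspace_vimage[OF module_path_space module_fun_space linear_map_antisym_map
            subspace_cycle_space])
    moreover have "submodule (carrier (fun_space (allowed_paths G 1) :: ('f, _) module)) scalars (\<Lambda> G 1)"
      unfolding path_space_def by (rule subspace_carrier_fun_space[OF allowed_paths_subset])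
    ultimately have "submodule (carrier (fun_space (allowed_paths G 1) :: ('f, _) module) \<inter>
        {g \<in> carrier (\<Lambda> G 1). ?\<alpha> g \<in> carrier (cycle_space G)}) scalars (\<Lambda> G 1)"
      by (intro subspace_Int[OF module_path_space])
    moreover have "carrier (fun_space (allowed_paths G 1) :: ('f, _) module) \<inter>
        {g \<in> carrier (\<Lambda> G 1). ?\<alpha> g \<in> carrier (cycle_space G)} = ?A"
      using AL by blast
    ultimately show ?thesis
      unfolding path_cycles_1_eq[OF G]
      using subspace_image[OF module_path_space module_regular_space[OF fin]
          linear_map_path_coset[OF fin]] by simp
  qed
  have Z: "module scalars ?Z"
    by (rule submodule.submodule_is_module[OF sub module_regular_space[OF fin]])
  have range: "induced_map ?\<alpha> p \<in> carrier (cycle_space G)" if "p \<in> path_cycles G 1" for p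
    using that ind AL unfolding path_cycles_1_eq[OF G] by auto
  have linZ: "linear_map ?Z (cycle_space G) (induced_map ?\<alpha>)"
    using linear_mapD[OF lin] range subspaceD(1)[OF sub] by (auto simp: linear_map_def subset_iff)
  have surj: "carrier (cycle_space G) \<subseteq> induced_map ?\<alpha> ` carrier ?Z"
  proof
    fix \<phi> :: "'a \<times> 'a \<Rightarrow> 'f" assume \<phi>: "\<phi> \<in> carrier (cycle_space G)"
    obtain g where g: "g \<in> carrier (fun_space (allowed_paths G 1))" "antisym_map G g = \<phi>"
      using antisym_map_surj[OF G char \<phi>] .
    then have gA: "g \<in> ?A" using \<phi> by simp
    then have "path_coset G 1 g \<in> path_cycles G 1" unfolding path_cycles_1_eq[OF G] by (rule imageI)
    moreover have "induced_map ?\<alpha> (path_coset G 1 g) = \<phi>" using ind[of g] gA AL g(2) by auto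
    ultimately show "\<phi> \<in> induced_map ?\<alpha> ` carrier ?Z" by force
  qed
  have ker: "path_boundaries G 1 = {p \<in> carrier ?Z. induced_map ?\<alpha> p \<in> TS G}"
  proof -
    have "path_coset G 1 g \<in> path_boundaries G 1 \<longleftrightarrow> induced_map ?\<alpha> (path_coset G 1 g) \<in> TS G"
      if "g \<in> carrier (fun_space (allowed_paths G 1))" for g :: "'a list \<Rightarrow> 'f"
    proof -
      have "g \<in> carrier (\<Lambda> G 1)" using that allowed_chains_subset by blast
      then show ?thesis using path_coset_boundaries_iff[OF G char that] ind by simp
    qed
    \<comment> \<open>That boundaries are cycles follows from the inclusion of \<open>TS G\<close> in the cycle space.\<close>
    moreover have "path_boundaries G 1 \<subseteq> (path_cycles G 1 :: ('a list \<Rightarrow> 'f) set set)"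
    proof
      fix p :: "('a list \<Rightarrow> 'f) set" assume p: "p \<in> path_boundaries G 1"
      then have "p \<in> allowed_space G 1" by (auto simp: path_boundaries_def Omega_def)
      then obtain g where g: "g \<in> carrier (fun_space (allowed_paths G 1))" "p = path_coset G 1 g"
        unfolding allowed_space_eq[OF fin] by blast
      then have "?\<alpha> g \<in> TS G" using p path_coset_boundaries_iff[OF G char g(1)] by simp
      then have "?\<alpha> g \<in> carrier (cycle_space G)" using subspaceD(1)[OF subspace_TS[OF G]] by blast
      then show "p \<in> path_cycles G 1" unfolding path_cycles_1_eq[OF G] using g by blast
    qed
    ultimately show ?thesis unfolding path_cycles_1_eq[OF G] by auto
  qed
  show ?thesis
    unfolding path_homology_def
    by (rule quotient_space_isomorphicI[OF Z module_cycle_space linZ surj subspace_TS[OF G] ker])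
qed

end
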